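(* Let $J_0,\ldots,J_N\in\mathbb{R}^{n\times n}$ and consider the time-invariant system $X(k+1)=\mathcal{D}(X(k))$, $X(0)=X_0\in\mathbb{S}^n_{\succeq0}$, where $\mathcal{D}:\mathbb{S}^n\to\mathbb{S}^n$, $\mathcal{D}(X)=\sum_{i=0}^NJ_iXJ_i^T$, and let $\mathcal{D}^*(P)=\sum_{i=0}^NJ_i^TPJ_i$. The following statements are equivalent: (a) The system is exponentially stable. (b) There exist constant matrices $P,Q\in\mathbb{S}^n_{\succ0}$ such that $\mathcal{D}^*(P)-P+Q=0$; and, equivalently, there exist $P\in\mathbb{S}^n_{\succ0}$ and $\alpha_3>0$ such that $\mathcal{D}^*(P)-P\preceq-\alpha_3I$. (c) The matrix $$\mathcal{M}_{\mathcal{D}}:=F^T\Big(\sum_{i=0}^NJ_i\otimes J_i\Big)F$$ is Schur stable, where $F\in\mathbb{R}^{n^2\times n(n+1)/2}$, $F^TF=I$, is the matrix such that $\mathrm{vec}(X)=F\,\overline{\mathrm{vec}}(X)$ for all $X\in\mathbb{S}^n$. (d) $\mathrm{sp}(\mathcal{D})\subset\mathbb{D}$, where $\mathrm{sp}(\mathcal{D}):=\{\lambda\in\mathbb{C}:\ \mathcal{D}(X)=\lambda X\text{ for some }X\in\mathbb{S}^n,\ X\ne0\}$.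
   Context: $\mathbb{S}^n$, $\mathbb{S}^n_{\succeq0}$, $\mathbb{S}^n_{\succ0}$ denote the real symmetric, positive semidefinite and positive definite $n\times n$ matrices; $\preceq$ is the Loewner order. $\mathbb{D}$ is the open unit disc of $\mathbb{C}$; Schur stable means all eigenvalues lie in $\mathbb{D}$. $\otimes$ is the Kronecker product and $\mathrm{vec}$ stacks the columns of a matrix. For $X\in\mathbb{S}^n$, $\overline{\mathrm{vec}}(X)\in\mathbb{R}^{n(n+1)/2}$ is the column vector with successive entries $X_{11},\sqrt2X_{21},\ldots,\sqrt2X_{n1},X_{22},\sqrt2X_{32},\ldots,\sqrt2X_{n2},\ldots,X_{nn}$. Exponentially stable means that there exist $\beta\ge1$, $\rho\in(0,1)$ such that $\|X(k)\|\le\beta\rho^k\|X_0\|$ for all $k\ge0$ and all $X_0\in\mathbb{S}^n_{\succeq0}$. *)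

theory Defs
  imports "Jordan_Normal_Form.Spectral_Radius"
begin

text \<open>Matrices and vectors are those of Jordan Normal Form: their dimensions are natural numbers,
  rows and columns are numbered from 0. This allows the sizes \<open>n\<close>, \<open>n ^ 2\<close> and \<open>n * (n + 1) div 2\<close>
  to occur in one statement.\<close>

definition sym_mats :: "nat \<Rightarrow> real mat set" where
  "sym_mats n = {A \<in> carrier_mat n n. A\<^sup>T = A}"

definition psd_mats :: "nat \<Rightarrow> real mat set" where
  "psd_mats n = {A \<in> sym_mats n. \<forall>v \<in> carrier_vec n. v \<bullet> (A *\<^sub>v v) \<ge> 0}"

definition pd_mats :: "nat \<Rightarrow> real mat set" where
  "pd_mats n = {A \<in> sym_mats n. \<forall>v \<in> carrier_vec n. v \<noteq> 0\<^sub>v n \<longrightarrow> v \<bullet> (A *\<^sub>v v) > 0}"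

definition loewner_le :: "nat \<Rightarrow> real mat \<Rightarrow> real mat \<Rightarrow> bool" where
  "loewner_le n A B \<longleftrightarrow> A \<in> sym_mats n \<and> B \<in> sym_mats n \<and> B - A \<in> psd_mats n"

text \<open>The norm is the operator norm induced by the Euclidean norm. All norms on a space of matrices
  are equivalent, so the choice affects only the constant \<open>\<beta>\<close> in exponential stability.\<close>

definition spectral_norm :: "real mat \<Rightarrow> real" where
  "spectral_norm A =
     (SUP v \<in> {v \<in> carrier_vec (dim_col A). sqrt (v \<bullet> v) \<le> 1}. sqrt ((A *\<^sub>v v) \<bullet> (A *\<^sub>v v)))"

text \<open>The matrix analogue of \<open>finsum_vec\<close>: the type of matrices of all sizes has no zero, so
  the sum is taken in the monoid of matrices of a given size.\<close>

definition finsum_mat :: "nat \<Rightarrow> nat \<Rightarrow> ('i \<Rightarrow> 'a :: comm_monoid_add mat) \<Rightarrow> 'i set \<Rightarrow> 'a mat" where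
  "finsum_mat nr nc = finprod (monoid_mat TYPE('a) nr nc)"

definition kron :: "'a :: times mat \<Rightarrow> 'a mat \<Rightarrow> 'a mat" where
  "kron A B = mat (dim_row A * dim_row B) (dim_col A * dim_col B)
     (\<lambda>(r, c). A $$ (r div dim_row B, c div dim_col B) * B $$ (r mod dim_row B, c mod dim_col B))"

definition vec_cols :: "'a mat \<Rightarrow> 'a vec" where
  "vec_cols X = vec (dim_row X * dim_col X) (\<lambda>k. X $$ (k mod dim_row X, k div dim_row X))"

definition lower_index :: "nat \<Rightarrow> (nat \<times> nat) list" where
  "lower_index n = concat (map (\<lambda>j. map (\<lambda>i. (i, j)) [j..<n]) [0..<n])"

definition half_vec :: "real mat \<Rightarrow> real vec" where
  "half_vec X = vec_of_list
     (map (\<lambda>(i, j). if i = j then X $$ (i, j) else sqrt 2 * X $$ (i, j)) (lower_index (dim_row X)))"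

definition is_dup_mat :: "nat \<Rightarrow> real mat \<Rightarrow> bool" where
  "is_dup_mat n F \<longleftrightarrow> F \<in> carrier_mat (n\<^sup>2) (n * (n + 1) div 2)
     \<and> F\<^sup>T * F = 1\<^sub>m (n * (n + 1) div 2)
     \<and> (\<forall>X \<in> sym_mats n. vec_cols X = F *\<^sub>v half_vec X)"

text \<open>Well defined by \<open>ex1_dup_mat\<close> below.\<close>

definition dup_mat :: "nat \<Rightarrow> real mat" where
  "dup_mat n = (THE F. is_dup_mat n F)"

definition D_op :: "nat \<Rightarrow> nat \<Rightarrow> (nat \<Rightarrow> real mat) \<Rightarrow> real mat \<Rightarrow> real mat" where
  "D_op n N J X = finsum_mat n n (\<lambda>i. J i * X * (J i)\<^sup>T) {0..N}"

definition D_adj :: "nat \<Rightarrow> nat \<Rightarrow> (nat \<Rightarrow> real mat) \<Rightarrow> real mat \<Rightarrow> real mat" where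
  "D_adj n N J P = finsum_mat n n (\<lambda>i. (J i)\<^sup>T * P * J i) {0..N}"

definition M_D :: "nat \<Rightarrow> nat \<Rightarrow> (nat \<Rightarrow> real mat) \<Rightarrow> real mat" where
  "M_D n N J = (dup_mat n)\<^sup>T * finsum_mat (n\<^sup>2) (n\<^sup>2) (\<lambda>i. kron (J i) (J i)) {0..N} * dup_mat n"

definition exp_stable :: "nat \<Rightarrow> (real mat \<Rightarrow> real mat) \<Rightarrow> bool" where
  "exp_stable n L \<longleftrightarrow> (\<exists>\<beta> \<rho> :: real. \<beta> \<ge> 1 \<and> 0 < \<rho> \<and> \<rho> < 1 \<and>
     (\<forall>X :: nat \<Rightarrow> real mat. X 0 \<in> psd_mats n \<and> (\<forall>k. X (Suc k) = L (X k)) \<longrightarrow>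
        (\<forall>k. spectral_norm (X k) \<le> \<beta> * \<rho> ^ k * spectral_norm (X 0))))"

abbreviation cplx_mat :: "real mat \<Rightarrow> complex mat" where
  "cplx_mat \<equiv> map_mat complex_of_real"

abbreviation unit_disc :: "complex set" where
  "unit_disc \<equiv> {z. cmod z < 1}"

definition schur_stable :: "real mat \<Rightarrow> bool" where
  "schur_stable A \<longleftrightarrow> spectrum (cplx_mat A) \<subseteq> unit_disc"

text \<open>As \<open>X\<close> is a real symmetric matrix, the equation \<open>L X = z X\<close> is one between complex matrices.\<close>

definition sp :: "nat \<Rightarrow> (real mat \<Rightarrow> real mat) \<Rightarrow> complex set" where
  "sp n L = {z. \<exists>X \<in> sym_mats n. X \<noteq> 0\<^sub>m n n \<and> cplx_mat (L X) = z \<cdot>\<^sub>m cplx_mat X}"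


lemma set_lower_index: "set (lower_index n) = {(i, j). j \<le> i \<and> i < n}"
  by (force simp: lower_index_def)

lemma distinct_lower_index: "distinct (lower_index n)"
proof -
  have "distinct (concat (map (\<lambda>j. map (\<lambda>i. (i, j)) [j..<n]) js))" if "distinct js" for js
    using that by (induction js) (auto simp: distinct_map inj_on_def)
  then show ?thesis by (simp add: lower_index_def)
qed

lemma length_lower_index: "length (lower_index n) = n * (n + 1) div 2"
proof -
  have "length (lower_index n) = (\<Sum>j\<leftarrow>[0..<n]. n - j)"
    by (simp add: lower_index_def length_concat comp_def)
  also have "\<dots> = (\<Sum>j<n. n - j)"
    by (simp add: interv_sum_list_conv_sum_set_nat atLeast0LessThan)
  also have "\<dots> = (\<Sum>j<n. Suc j)"
    by (rule sum.reindex_bij_witness[where i = "\<lambda>j. n - Suc j" and j = "\<lambda>j. n - Suc j"]) auto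
  also have "\<dots> = n * (n + 1) div 2"
    by (induction n) auto
  finally show ?thesis .
qed

theorem ex1_dup_mat: "\<exists>!F. is_dup_mat n F"
proof -
  define m where "m = n * (n + 1) div 2"
  define ix where "ix = lower_index n"
  define p where "p r = (max (r mod n) (r div n), min (r mod n) (r div n))" for r
  define w :: "nat \<Rightarrow> real" where "w r = (if r mod n = r div n then 1 else 1 / sqrt 2)" for r
  define F where "F = mat (n\<^sup>2) m (\<lambda>(r, k). if ix ! k = p r then w r else 0)"
  have len: "length ix = m" and dist: "distinct ix" and st: "set ix = {(i, j). j \<le> i \<and> i < n}"
    by (simp_all add: ix_def m_def length_lower_index distinct_lower_index set_lower_index)
  have F: "F \<in> carrier_mat (n\<^sup>2) m" by (simp add: F_def)
  have half: "half_vec X = vec m (\<lambda>k. (\<lambda>(i, j). if i = j then X $$ (i, j) else sqrt 2 * X $$ (i, j)) (ix ! k))"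
    if "dim_row X = n" for X
    using that len by (intro eq_vecI) (auto simp: half_vec_def ix_def vec_of_list_index simp flip: vec_of_list_map)
  have div: "r div n < n" "r mod n < n" "n > 0" if "r < n\<^sup>2" for r
  proof -
    show "n > 0" using that by (cases n) auto
    then show "r mod n < n" by simp
    show "r div n < n" using that by (simp add: power2_eq_square less_mult_imp_div_less)
  qed
  have vec: "vec_cols X = F *\<^sub>v half_vec X" if X: "X \<in> sym_mats n" for X
  proof (rule eq_vecI)
    have c: "dim_row X = n" "dim_col X = n" and t: "X\<^sup>T = X" using X by (auto simp: sym_mats_def)
    show "dim_vec (vec_cols X) = dim_vec (F *\<^sub>v half_vec X)"
      using c F by (simp add: vec_cols_def power2_eq_square)
    fix r assume "r < dim_vec (F *\<^sub>v half_vec X)"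
    then have r: "r < n\<^sup>2" using F by simp
    have sy: "X $$ (a, b) = X $$ (b, a)" if "a < n" "b < n" for a b
      using that c t index_transpose_mat(1)[of b X a] by simp
    have "p r \<in> set ix" using div[OF r] by (auto simp: st p_def)
    then obtain k0 where k0: "k0 < m" "ix ! k0 = p r" using len by (auto simp: in_set_conv_nth)
    have eq: "ix ! k = p r \<longleftrightarrow> k = k0" if "k < m" for k
      using that k0 dist len by (metis nth_eq_iff_index_eq)
    have "(F *\<^sub>v half_vec X) $ r = (\<Sum>k<m. F $$ (r, k) * half_vec X $ k)"
      using r F by (simp add: scalar_prod_def half[OF c(1)] atLeast0LessThan)
    also have "\<dots> = (\<Sum>k<m. if k = k0 then w r * half_vec X $ k else 0)"
      by (intro sum.cong) (auto simp: F_def r eq k0)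
    also have "\<dots> = w r * half_vec X $ k0" using k0 by simp
    also have "\<dots> = X $$ (r mod n, r div n)"
      using k0 div[OF r] sy[of "r mod n" "r div n"]
      by (auto simp: half[OF c(1)] p_def w_def max_def min_def)
    also have "\<dots> = vec_cols X $ r" using r c by (simp add: vec_cols_def power2_eq_square)
    finally show "vec_cols X $ r = (F *\<^sub>v half_vec X) $ r" by simp
  qed
  have orth: "F\<^sup>T * F = 1\<^sub>m m"
  proof (rule eq_matI)
    fix k l assume "k < dim_row (1\<^sub>m m)" "l < dim_col (1\<^sub>m m)"
    then have kl: "k < m" "l < m" by auto
    obtain i j where ij: "ix ! k = (i, j)" by (cases "ix ! k")
    have "(i, j) \<in> set ix" using ij kl len nth_mem by metis
    then have ijn: "j \<le> i" "i < n" by (auto simp: st)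
    have "(F\<^sup>T * F) $$ (k, l) = (\<Sum>r<n\<^sup>2. F $$ (r, k) * F $$ (r, l))"
      using kl F by (simp add: scalar_prod_def atLeast0LessThan)
    also have "\<dots> = (\<Sum>r<n\<^sup>2. if p r = (i, j) then (if k = l then (w r)\<^sup>2 else 0) else 0)"
    proof (intro sum.cong refl)
      fix r assume r: "r \<in> {..<n\<^sup>2}"
      have "ix ! k = ix ! l \<longleftrightarrow> k = l" using kl dist len by (metis nth_eq_iff_index_eq)
      then show "F $$ (r, k) * F $$ (r, l) = (if p r = (i, j) then (if k = l then (w r)\<^sup>2 else 0) else 0)"
        using r kl ij by (auto simp: F_def power2_eq_square)
    qed
    also have "\<dots> = (\<Sum>r\<in>{r\<in>{..<n\<^sup>2}. p r = (i, j)}. if k = l then (w r)\<^sup>2 else 0)"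
      by (simp add: sum.If_cases Int_def)
    also have "{r\<in>{..<n\<^sup>2}. p r = (i, j)} = {j * n + i, i * n + j}"
    proof (intro equalityI subsetI)
      fix r assume "r \<in> {r\<in>{..<n\<^sup>2}. p r = (i, j)}"
      then have "(r mod n = i \<and> r div n = j) \<or> (r mod n = j \<and> r div n = i)"
        by (auto simp: p_def max_def min_def split: if_splits)
      then show "r \<in> {j * n + i, i * n + j}" using div_mult_mod_eq[of r n] by auto
    next
      fix r assume "r \<in> {j * n + i, i * n + j}"
      moreover have "a * n + b < n\<^sup>2" if "a < n" "b < n" for a b
      proof -
        have "a * n + b < Suc a * n" using that by simp
        also have "\<dots> \<le> n * n" using that by (intro mult_le_mono1) simp
        finally show ?thesis by (simp add: power2_eq_square)
      qed
      ultimately show "r \<in> {r\<in>{..<n\<^sup>2}. p r = (i, j)}"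
        using ijn by (auto simp: p_def max_def min_def)
    qed
    also have "(\<Sum>r\<in>{j * n + i, i * n + j}. if k = l then (w r)\<^sup>2 else 0) = (if k = l then 1 else 0)"
    proof (cases "i = j")
      case True
      then show ?thesis using ijn by (simp add: w_def)
    next
      case False
      then have "j * n + i \<noteq> i * n + j" using ijn
        by (metis add.commute div_mult_self3 div_less add_cancel_right_left le_less_trans less_nat_zero_code)
      then show ?thesis using ijn False by (simp add: w_def power_divide)
    qed
    finally show "(F\<^sup>T * F) $$ (k, l) = 1\<^sub>m m $$ (k, l)" using kl by simp
  qed (use F in auto)
  show ?thesis
  proof (rule ex1I)
    show "is_dup_mat n F" using F vec orth by (simp add: is_dup_mat_def m_def)
    fix G assume "is_dup_mat n G"
    then have G: "G \<in> carrier_mat (n\<^sup>2) m" and vG: "\<And>X. X \<in> sym_mats n \<Longrightarrow> vec_cols X = G *\<^sub>v half_vec X"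
      by (auto simp: is_dup_mat_def m_def)
    show "G = F"
    proof (rule mat_col_eqI)
      fix k assume "k < dim_col F"
      then have k: "k < m" using F by simp
      define X where "X = mat n n (\<lambda>(i, j). if ix ! k = (max i j, min i j)
        then (if i = j then 1 else 1 / sqrt 2) else (0::real))"
      have X: "X \<in> sym_mats n"
        by (auto simp: sym_mats_def X_def max.commute min.commute)
      have "half_vec X = unit_vec m k"
      proof (rule eq_vecI)
        fix l assume "l < dim_vec (unit_vec m k)"
        then have l: "l < m" by simp
        obtain i j where ij: "ix ! l = (i, j)" by (cases "ix ! l")
        have "(i, j) \<in> set ix" using ij l len nth_mem by metis
        then have ijn: "j \<le> i" "i < n" by (auto simp: st)
        have "ix ! k = ix ! l \<longleftrightarrow> k = l" using k l dist len by (metis nth_eq_iff_index_eq)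
        then show "half_vec X $ l = unit_vec m k $ l"
          using ij ijn k l half[of X] by (auto simp: X_def max_def min_def)
      qed (use half[of X] in \<open>simp add: X_def\<close>)
      then have "G *\<^sub>v unit_vec m k = F *\<^sub>v unit_vec m k" using vG[OF X] vec[OF X] by simp
      moreover have "A *\<^sub>v unit_vec m k = col A k" if "A \<in> carrier_mat (n\<^sup>2) m" for A :: "real mat"
        using that k by (intro eq_vecI) auto
      ultimately show "col G k = col F k" using F G by simp
    qed (use F G in auto)
  qed
qed

end

theory Submission
  imports Defs
begin

text \<open>Half-vectorisation turns \<open>\<D>\<close> into \<open>\<M>\<close>, so decay of \<open>\<D>\<^sup>k\<close> on positive semidefinite matrices, which span
  the symmetric ones, forces \<open>\<M>\<^sup>k \<rightarrow> 0\<close>: (a) implies (c), and (c) implies (d). From (d), continuation of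
  the solution of \<open>P = s \<D>(P) + I\<close> from \<open>s = 0\<close> to \<open>s = 1\<close> gives a positive definite \<open>P\<close> with
  \<open>\<D>(P) - P + I = 0\<close>; no Perron-Frobenius theorem is needed. Any \<open>P, Q \<succ> 0\<close> with
  \<open>\<D>(P) - P + Q = 0\<close> satisfy \<open>\<D>(P) \<preceq> \<rho> P\<close> for some \<open>\<rho> < 1\<close>, so \<open>X\<^sub>0 \<preceq> a P\<close> implies \<open>X(k) \<preceq> a \<rho>\<^sup>k P\<close>, which
  is (a). Condition (b) concerns \<open>\<D>\<^sup>*\<close> rather than \<open>\<D>\<close>; it is reached by applying all this to the
  \<open>J\<^sub>i\<^sup>T\<close>, whose matrix is \<open>\<M>\<^sup>T\<close> and has the same spectrum.\<close>

section \<open>Quadratic forms and definiteness\<close>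

definition qf :: "real mat \<Rightarrow> real vec \<Rightarrow> real" where
  "qf A v = v \<bullet> (A *\<^sub>v v)"

text \<open>The entrywise l1 norm. It bounds both the quadratic form and the spectral norm, and as
  an explicit finite sum it depends continuously on the entries.\<close>

definition entry_sum :: "real mat \<Rightarrow> real" where
  "entry_sum A = (\<Sum>i<dim_row A. \<Sum>j<dim_col A. \<bar>A $$ (i, j)\<bar>)"

lemma qf_sum:
  assumes "A \<in> carrier_mat n n" "v \<in> carrier_vec n"
  shows "qf A v = (\<Sum>i<n. \<Sum>j<n. A $$ (i, j) * (v $ i * v $ j))"
  using assms
  by (auto simp: qf_def scalar_prod_def atLeast0LessThan sum_distrib_left mult_ac intro!: sum.cong)

lemma qf_add:
  assumes "A \<in> carrier_mat n n" "B \<in> carrier_mat n n" "v \<in> carrier_vec n"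
  shows "qf (A + B) v = qf A v + qf B v"
  using assms by (simp add: qf_sum[of _ n] sum.distrib algebra_simps)

lemma qf_diff:
  assumes "A \<in> carrier_mat n n" "B \<in> carrier_mat n n" "v \<in> carrier_vec n"
  shows "qf (A - B) v = qf A v - qf B v"
  unfolding qf_sum[OF minus_carrier_mat[OF assms(2)] assms(3)]
  using assms by (simp add: qf_sum[of _ n] left_diff_distrib sum_subtractf)

lemma qf_smult:
  assumes "A \<in> carrier_mat n n" "v \<in> carrier_vec n"
  shows "qf (a \<cdot>\<^sub>m A) v = a * qf A v"
  using assms by (simp add: qf_sum[of _ n] sum_distrib_left mult_ac)

lemma qf_one: "v \<in> carrier_vec n \<Longrightarrow> qf (1\<^sub>m n) v = v \<bullet> v"
  by (simp add: qf_def)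

lemma scalar_prod_self: "(v :: real vec) \<bullet> v = (\<Sum>i<dim_vec v. (v $ i)\<^sup>2)"
  by (simp add: scalar_prod_def atLeast0LessThan power2_eq_square)

lemma scalar_prod_self_nonneg: "(v :: real vec) \<bullet> v \<ge> 0"
  by (simp add: scalar_prod_self sum_nonneg)

lemma scalar_prod_self_pos: "v \<in> carrier_vec n \<Longrightarrow> v \<noteq> 0\<^sub>v n \<Longrightarrow> (v :: real vec) \<bullet> v > 0"
proof -
  assume v: "v \<in> carrier_vec n" "v \<noteq> 0\<^sub>v n"
  then obtain i where "i < n" "v $ i \<noteq> 0" by (metis carrier_vecD eq_vecI index_zero_vec)
  then show ?thesis unfolding scalar_prod_self using v by (intro sum_pos2[of _ i]) auto
qed

lemma component_sq_le: "i < dim_vec v \<Longrightarrow> (v $ i)\<^sup>2 \<le> (v :: real vec) \<bullet> v"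
  unfolding scalar_prod_self by (rule member_le_sum) auto

lemma component_mult_le:
  assumes "i < dim_vec v" "j < dim_vec v"
  shows "\<bar>v $ i * v $ j\<bar> \<le> (v :: real vec) \<bullet> v"
proof -
  have "2 * \<bar>v $ i * v $ j\<bar> \<le> (v $ i)\<^sup>2 + (v $ j)\<^sup>2"
    using sum_squares_bound[of "\<bar>v $ i\<bar>" "\<bar>v $ j\<bar>"] by (simp add: abs_mult)
  then show ?thesis using component_sq_le[OF assms(1)] component_sq_le[OF assms(2)] by linarith
qed

lemma entry_sum_nonneg: "entry_sum A \<ge> 0"
  by (simp add: entry_sum_def sum_nonneg)

lemma qf_abs_le:
  assumes "A \<in> carrier_mat n n" "v \<in> carrier_vec n"
  shows "\<bar>qf A v\<bar> \<le> entry_sum A * (v \<bullet> v)"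
proof -
  have "\<bar>qf A v\<bar> \<le> (\<Sum>i<n. \<Sum>j<n. \<bar>A $$ (i, j) * (v $ i * v $ j)\<bar>)"
    unfolding qf_sum[OF assms] by (intro order.trans[OF sum_abs] sum_mono) auto
  also have "\<dots> \<le> (\<Sum>i<n. \<Sum>j<n. \<bar>A $$ (i, j)\<bar> * (v \<bullet> v))"
  proof (intro sum_mono)
    fix i j assume "i \<in> {..<n}" "j \<in> {..<n}"
    then show "\<bar>A $$ (i, j) * (v $ i * v $ j)\<bar> \<le> \<bar>A $$ (i, j)\<bar> * (v \<bullet> v)"
      using component_mult_le[of i v j] assms by (simp add: abs_mult[of "A $$ (i, j)"] mult_left_mono)
  qed
  also have "\<dots> = entry_sum A * (v \<bullet> v)"
    using assms by (simp add: entry_sum_def sum_distrib_right)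
  finally show ?thesis .
qed

lemma psd_mats_iff: "A \<in> psd_mats n \<longleftrightarrow> A \<in> sym_mats n \<and> (\<forall>v \<in> carrier_vec n. qf A v \<ge> 0)"
  by (simp add: psd_mats_def qf_def)

lemma pd_mats_iff:
  "A \<in> pd_mats n \<longleftrightarrow> A \<in> sym_mats n \<and> (\<forall>v \<in> carrier_vec n. v \<noteq> 0\<^sub>v n \<longrightarrow> qf A v > 0)"
  by (simp add: pd_mats_def qf_def)

lemma sym_mats_iff:
  "A \<in> sym_mats n \<longleftrightarrow> A \<in> carrier_mat n n \<and> (\<forall>i<n. \<forall>j<n. A $$ (i, j) = A $$ (j, i))"
  by (auto simp: sym_mats_def mat_eq_iff)

lemma sym_mats_carrier: "A \<in> sym_mats n \<Longrightarrow> A \<in> carrier_mat n n"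
  by (simp add: sym_mats_def)

lemma sym_mats_add: "A \<in> sym_mats n \<Longrightarrow> B \<in> sym_mats n \<Longrightarrow> A + B \<in> sym_mats n"
  and sym_mats_diff: "A \<in> sym_mats n \<Longrightarrow> B \<in> sym_mats n \<Longrightarrow> A - B \<in> sym_mats n"
  and sym_mats_smult: "A \<in> sym_mats n \<Longrightarrow> a \<cdot>\<^sub>m A \<in> sym_mats n"
  and sym_mats_one: "1\<^sub>m n \<in> sym_mats n"
  by (auto simp: sym_mats_iff)

lemma pd_mats_psd: "A \<in> pd_mats n \<Longrightarrow> A \<in> psd_mats n"
  unfolding pd_mats_iff psd_mats_iff
proof (safe, goal_cases)
  case (1 v)
  then show ?case
    by (cases "v = 0\<^sub>v n") (force simp: qf_def sym_mats_def, simp add: less_imp_le)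
qed

lemma pd_mats_one: "1\<^sub>m n \<in> pd_mats n"
  by (simp add: pd_mats_iff sym_mats_one qf_one scalar_prod_self_pos)

text \<open>With \<open>B\<close> the inverse of \<open>A\<close>, the bound comes from \<open>qf A (v - B v / c) \<ge> 0\<close>
  for \<open>c\<close> large; this avoids minimising over the unit sphere.\<close>

lemma pd_mats_lower_bound:
  assumes "A \<in> pd_mats n"
  obtains c where "c > 0" "\<And>v. v \<in> carrier_vec n \<Longrightarrow> qf A v \<ge> c * (v \<bullet> v)"
proof -
  have A: "A \<in> carrier_mat n n" and At: "A\<^sup>T = A" using assms by (auto simp: pd_mats_def sym_mats_def)
  have "det A \<noteq> 0"
  proof
    assume "det A = 0"
    then obtain v where v: "v \<in> carrier_vec n" "v \<noteq> 0\<^sub>v n" "A *\<^sub>v v = 0\<^sub>v n"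
      using det_0_iff_vec_prod_zero_field[OF A] by auto
    then have "qf A v = 0" by (simp add: qf_def)
    then show False using assms v by (auto simp: pd_mats_iff)
  qed
  then obtain B where B: "B \<in> carrier_mat n n" "A * B = 1\<^sub>m n"
    using det_non_zero_imp_unit[OF A, of "()"] by (auto simp: Units_def ring_mat_def)
  \<comment> \<open>\<open>c\<close> bounds the quadratic form of the inverse \<open>B\<close>; the
    added 1 keeps it positive even for \<open>n = 0\<close>.\<close>
  define c where "c = entry_sum B + 1"
  have c: "c > 0" using entry_sum_nonneg[of B] by (simp add: c_def)
  show thesis
  proof
    show "1 / c > 0" using c by simp
    fix v :: "real vec" assume v: "v \<in> carrier_vec n"
    define w where "w = B *\<^sub>v v"
    have w: "w \<in> carrier_vec n" using B v by (simp add: w_def)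
    have Aw: "A *\<^sub>v w = v" unfolding w_def using A B v
      by (metis assoc_mult_mat_vec one_mult_mat_vec)
    have wAv: "w \<bullet> (A *\<^sub>v v) = v \<bullet> v"
      using transpose_vec_mult_scalar[OF A v w] At Aw by simp
    define t where "t = 1 / c"
    have "0 \<le> qf A (v - t \<cdot>\<^sub>v w)"
      using pd_mats_psd[OF assms] v w by (auto simp: psd_mats_iff)
    also have "A *\<^sub>v (v - t \<cdot>\<^sub>v w) = A *\<^sub>v v - t \<cdot>\<^sub>v v"
      using A v w Aw by (simp add: mult_minus_distrib_mat_vec[of _ n n] mult_mat_vec)
    then have "qf A (v - t \<cdot>\<^sub>v w) = (v - t \<cdot>\<^sub>v w) \<bullet> (A *\<^sub>v v - t \<cdot>\<^sub>v v)"
      by (simp add: qf_def)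
    \<comment> \<open>Both cross terms equal \<open>v \<bullet> v\<close> up to the factor
      \<open>- t\<close>, since \<open>A *\<^sub>v w = v\<close> and \<open>A\<close> is symmetric.
      The last term is at most \<open>t * (v \<bullet> v)\<close>, so one of the two copies of
      \<open>t * (v \<bullet> v)\<close> survives as lower bound for \<open>qf A v\<close>.\<close>
    also have "\<dots> = qf A v - t * (v \<bullet> v) - t * (v \<bullet> v) + t * t * (v \<bullet> w)"
      using v w A wAv comm_scalar_prod[OF v w]
      by (simp add: qf_def minus_scalar_prod_distrib[of _ n] scalar_prod_minus_distrib[of _ n] algebra_simps)
    also have "v \<bullet> w \<le> c * (v \<bullet> v)"
      using qf_abs_le[OF B(1) v] scalar_prod_self_nonneg[of v]
      by (simp add: qf_def w_def c_def algebra_simps)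
    then have "t * t * (v \<bullet> w) \<le> t * (v \<bullet> v)"
      using c mult_left_mono[of "v \<bullet> w" "c * (v \<bullet> v)" "t * t"] by (simp add: t_def field_simps)
    finally show "qf A v \<ge> 1 / c * (v \<bullet> v)" by (simp add: t_def)
  qed
qed

text \<open>The form at a unit vector is a diagonal entry, which therefore lies between 0 and
  \<open>b\<close>. Nonnegativity at the sum and at the difference of two unit vectors bounds twice
  the modulus of the off-diagonal entry by the sum of two diagonal entries.\<close>

lemma psd_entry_le:
  assumes A: "A \<in> psd_mats n" and b: "\<And>v. v \<in> carrier_vec n \<Longrightarrow> qf A v \<le> b * (v \<bullet> v)"
    and ij: "i < n" "j < n"
  shows "\<bar>A $$ (i, j)\<bar> \<le> b"
proof -
  have sym: "A $$ (i, j) = A $$ (j, i)" and Ac: "A \<in> carrier_mat n n"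
    using A ij by (auto simp: psd_mats_iff sym_mats_iff)
  have diag: "qf A (unit_vec n k) = A $$ (k, k)" if "k < n" for k
    using that Ac by (simp add: qf_def)
  have le: "A $$ (k, k) \<le> b \<and> A $$ (k, k) \<ge> 0" if "k < n" for k
    using b[of "unit_vec n k"] that A diag[OF that, symmetric] by (simp add: psd_mats_iff)
  show ?thesis
  proof (cases "i = j")
    case True
    then show ?thesis using le[of i] ij by simp
  next
    case False
    have "qf A (unit_vec n i + s \<cdot>\<^sub>v unit_vec n j)
        = A $$ (i, i) + s * A $$ (i, j) + s * A $$ (j, i) + s * s * A $$ (j, j)" for s
      using ij Ac
      by (simp add: qf_def mult_add_distrib_mat_vec[of _ n n] mult_mat_vec[of _ n n]
          add_scalar_prod_distrib[of _ n] scalar_prod_add_distrib[of _ n] algebra_simps)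
    moreover have "qf A (unit_vec n i + s \<cdot>\<^sub>v unit_vec n j) \<ge> 0" for s
      using A by (auto simp: psd_mats_iff)
    ultimately have "A $$ (i, i) + s * A $$ (i, j) + s * A $$ (j, i) + s * s * A $$ (j, j) \<ge> 0" for s
      by metis
    from this[of 1] this[of "-1"] show ?thesis using le[OF ij(1)] le[OF ij(2)] sym by auto
  qed
qed

section \<open>Spectral norm and entries\<close>

lemma sqrt_sum_squares_le_sum_abs:
  "sqrt (\<Sum>i<n. (f i)\<^sup>2) \<le> (\<Sum>i<n. \<bar>f i :: real\<bar>)" for n :: nat
proof (induction n)
  case (Suc n)
  have "sqrt ((\<Sum>i<n. (f i)\<^sup>2) + (f n)\<^sup>2) \<le> sqrt (\<Sum>i<n. (f i)\<^sup>2) + sqrt ((f n)\<^sup>2)"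
    by (intro sqrt_add_le_add_sqrt sum_nonneg) auto
  then show ?case using Suc by simp
qed simp

text \<open>Both claims rest on one bound over the unit ball: a supremum of reals can be used only
  once the set is known to be nonempty (the zero vector) and bounded above (by
  \<open>entry_sum A\<close>).\<close>

lemma spectral_norm_le_entry_sum: "spectral_norm A \<le> entry_sum A"
  and norm_mult_le_spectral_norm:
    "v \<in> carrier_vec (dim_col A) \<Longrightarrow> v \<bullet> v \<le> 1 \<Longrightarrow> sqrt ((A *\<^sub>v v) \<bullet> (A *\<^sub>v v)) \<le> spectral_norm A"
proof -
  let ?V = "{v \<in> carrier_vec (dim_col A). sqrt (v \<bullet> v) \<le> 1}"
  have bound: "sqrt ((A *\<^sub>v v) \<bullet> (A *\<^sub>v v)) \<le> entry_sum A" if "v \<in> ?V" for v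
  proof -
    have v: "dim_vec v = dim_col A" "v \<bullet> v \<le> 1" using that by auto
    have vj: "\<bar>v $ j\<bar> \<le> 1" if "j < dim_col A" for j
      using component_sq_le[of j v] that v by (simp add: abs_square_le_1[symmetric])
    have "sqrt ((A *\<^sub>v v) \<bullet> (A *\<^sub>v v)) \<le> (\<Sum>i<dim_row A. \<bar>(A *\<^sub>v v) $ i\<bar>)"
      unfolding scalar_prod_self using sqrt_sum_squares_le_sum_abs by simp
    also have "\<dots> \<le> entry_sum A"
      unfolding entry_sum_def
    proof (rule sum_mono)
      fix i assume "i \<in> {..<dim_row A}"
      then have "(A *\<^sub>v v) $ i = (\<Sum>j<dim_col A. A $$ (i, j) * v $ j)"
        using v by (simp add: scalar_prod_def atLeast0LessThan)
      also have "\<bar>\<dots>\<bar> \<le> (\<Sum>j<dim_col A. \<bar>A $$ (i, j)\<bar>)"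
        using vj by (intro order.trans[OF sum_abs] sum_mono) (simp add: abs_mult mult_left_le)
      finally show "\<bar>(A *\<^sub>v v) $ i\<bar> \<le> (\<Sum>j<dim_col A. \<bar>A $$ (i, j)\<bar>)" .
    qed
    finally show ?thesis .
  qed
  have "0\<^sub>v (dim_col A) \<in> ?V" by simp
  then show "spectral_norm A \<le> entry_sum A"
    unfolding spectral_norm_def using bound by (intro cSUP_least) blast+
  assume "v \<in> carrier_vec (dim_col A)" "v \<bullet> v \<le> 1"
  then show "sqrt ((A *\<^sub>v v) \<bullet> (A *\<^sub>v v)) \<le> spectral_norm A"
    unfolding spectral_norm_def using bound by (intro cSUP_upper bdd_aboveI2) auto
qed

text \<open>An entry is a component of the image of a unit vector. With
  \<open>spectral_norm_le_entry_sum\<close> this compares the spectral norm with the entries in both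
  directions, up to a factor depending on the dimensions.\<close>

lemma entry_le_spectral_norm:
  assumes "i < dim_row A" "j < dim_col A"
  shows "\<bar>A $$ (i, j)\<bar> \<le> spectral_norm A"
proof -
  let ?w = "A *\<^sub>v unit_vec (dim_col A) j"
  have "?w $ i = A $$ (i, j)" using assms by simp
  then have "\<bar>A $$ (i, j)\<bar> = sqrt ((?w $ i)\<^sup>2)" by simp
  also have "\<dots> \<le> sqrt (?w \<bullet> ?w)" using component_sq_le[of i ?w] assms by (intro real_sqrt_le_mono) simp
  also have "\<dots> \<le> spectral_norm A" using assms by (intro norm_mult_le_spectral_norm) auto
  finally show ?thesis .
qed


section \<open>Sums of matrices and the half-vectorisation\<close>

text \<open>One induction yields both claims, because the entries of a sum of two matrices are known
  only once the dimensions of the partial sum are.\<close>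

lemma
  fixes f :: "'i \<Rightarrow> 'a :: comm_monoid_add mat"
  assumes "finite I" "\<And>i. i \<in> I \<Longrightarrow> f i \<in> carrier_mat nr nc"
  shows finsum_mat_carrier: "finsum_mat nr nc f I \<in> carrier_mat nr nc"
    and finsum_mat_index:
      "r < nr \<Longrightarrow> c < nc \<Longrightarrow> finsum_mat nr nc f I $$ (r, c) = (\<Sum>i\<in>I. f i $$ (r, c))"
proof -
  interpret comm_monoid "monoid_mat TYPE('a) nr nc" by (rule comm_monoid_mat)
  have "finsum_mat nr nc f I \<in> carrier_mat nr nc \<and>
    (r < nr \<longrightarrow> c < nc \<longrightarrow> finsum_mat nr nc f I $$ (r, c) = (\<Sum>i\<in>I. f i $$ (r, c)))" for r c
    using assms
  proof (induction I)
    case empty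
    have "finsum_mat nr nc f {} = 0\<^sub>m nr nc"
      unfolding finsum_mat_def finprod_empty by (simp add: monoid_mat_def)
    then show ?case by simp
  next
    case (insert x I)
    then have "f \<in> I \<rightarrow> carrier_mat nr nc" "f x \<in> carrier_mat nr nc" by auto
    then have "finsum_mat nr nc f (insert x I) = f x + finsum_mat nr nc f I"
      using insert.hyps finprod_insert[of I x f] by (simp add: finsum_mat_def monoid_mat_def)
    moreover have fx: "f x \<in> carrier_mat nr nc" and
      IH: "finsum_mat nr nc f I \<in> carrier_mat nr nc"
        "r < nr \<Longrightarrow> c < nc \<Longrightarrow> finsum_mat nr nc f I $$ (r, c) = (\<Sum>i\<in>I. f i $$ (r, c))"
      using insert.IH insert.prems by blast+
    ultimately show ?case using insert.hyps by simp
  qed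
  then show "finsum_mat nr nc f I \<in> carrier_mat nr nc"
    and "r < nr \<Longrightarrow> c < nc \<Longrightarrow> finsum_mat nr nc f I $$ (r, c) = (\<Sum>i\<in>I. f i $$ (r, c))"
    by blast+
qed

lemma qf_finsum_mat:
  assumes "finite I" "\<And>i. i \<in> I \<Longrightarrow> f i \<in> carrier_mat n n" "v \<in> carrier_vec n"
  shows "qf (finsum_mat n n f I) v = (\<Sum>i\<in>I. qf (f i) v)"
proof -
  have F: "finsum_mat n n f I \<in> carrier_mat n n" using assms by (intro finsum_mat_carrier) auto
  have "qf (finsum_mat n n f I) v = (\<Sum>r<n. \<Sum>c<n. \<Sum>i\<in>I. f i $$ (r, c) * (v $ r * v $ c))"
    unfolding qf_sum[OF F assms(3)]
    using assms(1,2) by (simp add: finsum_mat_index sum_distrib_right)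
  also have "\<dots> = (\<Sum>r<n. \<Sum>i\<in>I. \<Sum>c<n. f i $$ (r, c) * (v $ r * v $ c))"
    by (intro sum.cong refl sum.swap)
  also have "\<dots> = (\<Sum>i\<in>I. \<Sum>r<n. \<Sum>c<n. f i $$ (r, c) * (v $ r * v $ c))"
    by (rule sum.swap)
  also have "\<dots> = (\<Sum>i\<in>I. qf (f i) v)"
    using qf_sum[OF assms(2,3)] by (intro sum.cong) auto
  finally show ?thesis .
qed

lemma finsum_mat_mult_vec_index:
  fixes f :: "'i \<Rightarrow> 'a :: comm_semiring_0 mat"
  assumes "finite I" "\<And>i. i \<in> I \<Longrightarrow> f i \<in> carrier_mat nr nc" "v \<in> carrier_vec nc" "r < nr"
  shows "(finsum_mat nr nc f I *\<^sub>v v) $ r = (\<Sum>i\<in>I. (f i *\<^sub>v v) $ r)"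
proof -
  have c: "finsum_mat nr nc f I \<in> carrier_mat nr nc" using assms by (intro finsum_mat_carrier) auto
  have "(finsum_mat nr nc f I *\<^sub>v v) $ r = (\<Sum>k<nc. \<Sum>i\<in>I. f i $$ (r, k) * v $ k)"
    using assms c
    by (auto simp: scalar_prod_def atLeast0LessThan finsum_mat_index sum_distrib_right intro!: sum.cong)
  also have "\<dots> = (\<Sum>i\<in>I. (f i *\<^sub>v v) $ r)"
  proof (subst sum.swap, intro sum.cong refl)
    fix i assume "i \<in> I"
    then have "f i \<in> carrier_mat nr nc" using assms by auto
    then show "(\<Sum>k<nc. f i $$ (r, k) * v $ k) = (f i *\<^sub>v v) $ r"
      using assms by (simp add: scalar_prod_def atLeast0LessThan)
  qed
  finally show ?thesis .
qed

section \<open>Kronecker products and column stacking\<close>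

lemma kron_carrier: "A \<in> carrier_mat n n \<Longrightarrow> B \<in> carrier_mat n n \<Longrightarrow> kron A B \<in> carrier_mat (n\<^sup>2) (n\<^sup>2)"
  by (simp add: kron_def power2_eq_square)

lemma div_mod_less_square:
  assumes "r < (n :: nat)\<^sup>2"
  shows "r div n < n" "r mod n < n"
proof -
  have "n > 0" using assms by (cases n) auto
  then show "r mod n < n" by simp
  show "r div n < n" using assms by (simp add: power2_eq_square less_mult_imp_div_less)
qed

lemma mult_add_less_square:
  assumes "a < (n :: nat)" "b < n"
  shows "a * n + b < n\<^sup>2"
proof -
  have "a * n + b < Suc a * n" using assms by simp
  also have "\<dots> \<le> n * n" using assms by (intro mult_le_mono1) simp
  finally show ?thesis by (simp add: power2_eq_square)
qed

text \<open>Position \<open>k\<close> of a column-stacked matrix is the entry in column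
  \<open>k div n\<close> and row \<open>k mod n\<close>. This bijection splits a sum over positions
  into a double sum.\<close>

lemma sum_square_div_mod:
  fixes g :: "nat \<Rightarrow> nat \<Rightarrow> 'a :: comm_monoid_add"
  shows "(\<Sum>k<n\<^sup>2. g (k div n) (k mod n)) = (\<Sum>b<n. \<Sum>a<n. g b a)"
proof -
  have "bij_betw (\<lambda>k. (k div n, k mod n)) {..<n\<^sup>2} ({..<n} \<times> {..<n})"
  proof (rule bij_betw_byWitness[where f' = "\<lambda>(b, a). b * n + a"])
    show "(\<lambda>(b, a). b * n + a) ` ({..<n} \<times> {..<n}) \<subseteq> {..<n\<^sup>2}"
      using mult_add_less_square[of _ n] by auto
    show "(\<lambda>k. (k div n, k mod n)) ` {..<n\<^sup>2} \<subseteq> {..<n} \<times> {..<n}"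
      using div_mod_less_square[of _ n] by auto
  qed auto
  from sum.reindex_bij_betw[OF this, of "\<lambda>(b, a). g b a"] show ?thesis
    by (simp add: sum.cartesian_product)
qed

lemma vec_cols_index: "X \<in> carrier_mat n n \<Longrightarrow> k < n\<^sup>2 \<Longrightarrow> vec_cols X $ k = X $$ (k mod n, k div n)"
  and vec_cols_carrier: "X \<in> carrier_mat n n \<Longrightarrow> vec_cols X \<in> carrier_vec (n\<^sup>2)"
  by (auto simp: vec_cols_def power2_eq_square)

lemma vec_cols_inj:
  assumes "X \<in> carrier_mat n n" "Y \<in> carrier_mat n n" "vec_cols X = vec_cols Y"
  shows "X = Y"
proof (rule eq_matI)
  fix i j assume "i < dim_row Y" "j < dim_col Y"
  then have ij: "i < n" "j < n" using assms by auto
  then show "X $$ (i, j) = Y $$ (i, j)"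
    using vec_cols_index[OF assms(1) mult_add_less_square[OF ij(2,1)]]
      vec_cols_index[OF assms(2) mult_add_less_square[OF ij(2,1)]] assms(3) by simp
qed (use assms in auto)

text \<open>Under column stacking the first Kronecker factor acts on the column index, hence as a
  transpose from the right, and the second acts on the row index, hence from the left.\<close>

lemma kron_mult_vec_cols:
  fixes A B X :: "real mat"
  assumes "A \<in> carrier_mat n n" "B \<in> carrier_mat n n" "X \<in> carrier_mat n n"
  shows "kron A B *\<^sub>v vec_cols X = vec_cols (B * X * A\<^sup>T)"
proof (rule eq_vecI)
  have BXA: "B * X * A\<^sup>T \<in> carrier_mat n n" using assms by simp
  have K: "kron A B \<in> carrier_mat (n\<^sup>2) (n\<^sup>2)" using assms by (intro kron_carrier)
  show "dim_vec (kron A B *\<^sub>v vec_cols X) = dim_vec (vec_cols (B * X * A\<^sup>T))"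
    using K vec_cols_carrier[OF BXA] by simp
  fix r assume "r < dim_vec (vec_cols (B * X * A\<^sup>T))"
  then have r: "r < n\<^sup>2" using vec_cols_carrier[OF BXA] by simp
  note rn = div_mod_less_square[OF r]
  have "(kron A B *\<^sub>v vec_cols X) $ r = (\<Sum>k<n\<^sup>2. kron A B $$ (r, k) * vec_cols X $ k)"
    using r K vec_cols_carrier[OF assms(3)] by (simp add: scalar_prod_def atLeast0LessThan)
  also have "\<dots> = (\<Sum>k<n\<^sup>2. A $$ (r div n, k div n) * B $$ (r mod n, k mod n) * X $$ (k mod n, k div n))"
    using r assms by (intro sum.cong) (auto simp: vec_cols_index[of _ n] kron_def power2_eq_square)
  also have "\<dots> = (\<Sum>b<n. \<Sum>a<n. A $$ (r div n, b) * B $$ (r mod n, a) * X $$ (a, b))"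
    by (rule sum_square_div_mod)
  also have "\<dots> = (B * X * A\<^sup>T) $$ (r mod n, r div n)"
    using rn assms
    by (simp add: assoc_mult_mat[of _ n n] scalar_prod_def atLeast0LessThan sum_distrib_left)
      (subst sum.swap, simp add: mult_ac)
  also have "\<dots> = vec_cols (B * X * A\<^sup>T) $ r" using r BXA by (simp add: vec_cols_index)
  finally show "(kron A B *\<^sub>v vec_cols X) $ r = vec_cols (B * X * A\<^sup>T) $ r" .
qed

section \<open>Half-vectorisation as a linear isomorphism\<close>

definition half_dim :: "nat \<Rightarrow> nat" where
  "half_dim n = n * (n + 1) div 2"

lemma dup_mat: "is_dup_mat n (dup_mat n)"
  unfolding dup_mat_def by (rule theI'[OF ex1_dup_mat])

lemma dup_mat_carrier: "dup_mat n \<in> carrier_mat (n\<^sup>2) (half_dim n)"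
  and dup_mat_orthogonal: "(dup_mat n)\<^sup>T * dup_mat n = 1\<^sub>m (half_dim n)"
  and dup_mat_half_vec: "X \<in> sym_mats n \<Longrightarrow> dup_mat n *\<^sub>v half_vec X = vec_cols X"
proof -
  note conj = dup_mat[of n, unfolded is_dup_mat_def, folded half_dim_def]
  show "dup_mat n \<in> carrier_mat (n\<^sup>2) (half_dim n)" by (rule conjunct1[OF conj])
  show "(dup_mat n)\<^sup>T * dup_mat n = 1\<^sub>m (half_dim n)"
    by (rule conjunct1[OF conjunct2[OF conj]])
  show "X \<in> sym_mats n \<Longrightarrow> dup_mat n *\<^sub>v half_vec X = vec_cols X"
    by (rule bspec[OF conjunct2[OF conjunct2[OF conj]], symmetric])
qed

lemma half_vec_carrier: "X \<in> carrier_mat n n \<Longrightarrow> half_vec X \<in> carrier_vec (half_dim n)"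
  unfolding half_dim_def length_lower_index[symmetric] by (intro carrier_vecI) (simp add: half_vec_def)

lemma lower_index_cases:
  assumes "k < half_dim n"
  obtains i j where "lower_index n ! k = (i, j)" "j \<le> i" "i < n" "j < n"
proof -
  obtain i j where ij: "lower_index n ! k = (i, j)" by (cases "lower_index n ! k")
  have "lower_index n ! k \<in> set (lower_index n)"
    using assms by (simp add: length_lower_index half_dim_def)
  then show thesis using that ij by (auto simp: set_lower_index)
qed

lemma half_vec_index:
  assumes "X \<in> carrier_mat n n" "k < half_dim n" "lower_index n ! k = (i, j)"
  shows "half_vec X $ k = (if i = j then 1 else sqrt 2) * X $$ (i, j)"
  using assms
  by (auto simp: half_vec_def vec_of_list_index length_lower_index half_dim_def simp flip: vec_of_list_map)

lemma half_vec_inj: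
  assumes "X \<in> sym_mats n" "Y \<in> sym_mats n" "half_vec X = half_vec Y"
  shows "X = Y"
proof (rule vec_cols_inj[OF sym_mats_carrier[OF assms(1)] sym_mats_carrier[OF assms(2)]])
  show "vec_cols X = vec_cols Y"
    unfolding dup_mat_half_vec[OF assms(1), symmetric] dup_mat_half_vec[OF assms(2), symmetric] assms(3) ..
qed

lemma half_vec_add:
  assumes "X \<in> carrier_mat n n" "Y \<in> carrier_mat n n"
  shows "half_vec (X + Y) = half_vec X + half_vec Y"
proof (rule eq_vecI)
  have XY: "X + Y \<in> carrier_mat n n" using assms by simp
  show "dim_vec (half_vec (X + Y)) = dim_vec (half_vec X + half_vec Y)"
    using half_vec_carrier[OF XY] half_vec_carrier[OF assms(2)] by simp
  fix k assume "k < dim_vec (half_vec X + half_vec Y)"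
  then have k: "k < half_dim n" using half_vec_carrier[OF assms(2)] by simp
  obtain i j where ij: "lower_index n ! k = (i, j)" "j \<le> i" "i < n" "j < n"
    by (rule lower_index_cases[OF k])
  show "half_vec (X + Y) $ k = (half_vec X + half_vec Y) $ k"
    using assms k ij half_vec_carrier[OF assms(2)]
    by (simp add: half_vec_index[OF XY k ij(1)] half_vec_index[OF assms(1) k ij(1)]
        half_vec_index[OF assms(2) k ij(1)] distrib_left)
qed

lemma half_vec_smult:
  assumes "X \<in> carrier_mat n n"
  shows "half_vec (a \<cdot>\<^sub>m X) = a \<cdot>\<^sub>v half_vec X"
proof (rule eq_vecI)
  have aX: "a \<cdot>\<^sub>m X \<in> carrier_mat n n" using assms by simp
  show "dim_vec (half_vec (a \<cdot>\<^sub>m X)) = dim_vec (a \<cdot>\<^sub>v half_vec X)"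
    using half_vec_carrier[OF aX] half_vec_carrier[OF assms] by simp
  fix k assume "k < dim_vec (a \<cdot>\<^sub>v half_vec X)"
  then have k: "k < half_dim n" using half_vec_carrier[OF assms] by simp
  obtain i j where ij: "lower_index n ! k = (i, j)" "j \<le> i" "i < n" "j < n"
    by (rule lower_index_cases[OF k])
  show "half_vec (a \<cdot>\<^sub>m X) $ k = (a \<cdot>\<^sub>v half_vec X) $ k"
    using assms k ij half_vec_carrier[OF assms]
    by (simp add: half_vec_index[OF aX k ij(1)] half_vec_index[OF assms k ij(1)])
qed

text \<open>The enumeration of the lower triangle is inverted and the weight \<open>sqrt 2\<close>
  undone. Together with injectivity this lets eigenvectors and linear equations for
  \<open>M_D\<close> be read as statements about symmetric matrices.\<close>

lemma half_vec_surj: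
  assumes "y \<in> carrier_vec (half_dim n)"
  obtains X where "X \<in> sym_mats n" "half_vec X = y"
proof -
  let ?ix = "lower_index n"
  have len: "length ?ix = half_dim n" by (simp add: length_lower_index half_dim_def)
  \<comment> \<open>\<open>pos\<close> is the inverse of the enumeration; it is unique on the range
    because the list is distinct.\<close>
  define pos where "pos p = (SOME k. k < half_dim n \<and> ?ix ! k = p)" for p
  have pos: "pos (?ix ! k) = k" if "k < half_dim n" for k
    unfolding pos_def
  proof (rule some_equality)
    show "l = k" if "l < half_dim n \<and> ?ix ! l = ?ix ! k" for l
      using that \<open>k < half_dim n\<close> len nth_eq_iff_index_eq[OF distinct_lower_index[of n]] by metis
  qed (use that in simp)
  define X where "X = mat n n (\<lambda>(i, j). if i = j then y $ pos (i, j)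
    else if j < i then y $ pos (i, j) / sqrt 2 else y $ pos (j, i) / sqrt 2)"
  have X: "X \<in> sym_mats n" by (simp add: X_def sym_mats_iff)
  have "half_vec X = y"
  proof (rule eq_vecI)
    fix k assume "k < dim_vec y"
    then have k: "k < half_dim n" using assms by simp
    obtain i j where ij: "?ix ! k = (i, j)" "j \<le> i" "i < n" "j < n"
      by (rule lower_index_cases[OF k])
    show "half_vec X $ k = y $ k"
      unfolding half_vec_index[OF sym_mats_carrier[OF X] k ij(1)]
      using ij pos[OF k] by (cases "i = j") (simp_all add: X_def)
  next
    show "dim_vec (half_vec X) = dim_vec y"
      using half_vec_carrier[OF sym_mats_carrier[OF X]] assms by simp
  qed
  with X show thesis by (rule that)
qed

lemma half_vec_zero: "half_vec (0\<^sub>m n n) = 0\<^sub>v (half_dim n)"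
proof (rule eq_vecI)
  have Z: "0\<^sub>m n n \<in> carrier_mat n n" by simp
  show "dim_vec (half_vec (0\<^sub>m n n)) = dim_vec (0\<^sub>v (half_dim n) :: real vec)"
    using half_vec_carrier[OF Z] by simp
  fix k assume "k < dim_vec (0\<^sub>v (half_dim n) :: real vec)"
  then have k: "k < half_dim n" by simp
  obtain i j where ij: "lower_index n ! k = (i, j)" "j \<le> i" "i < n" "j < n"
    by (rule lower_index_cases[OF k])
  show "half_vec (0\<^sub>m n n) $ k = 0\<^sub>v (half_dim n) $ k"
    using k ij by (simp add: half_vec_index[OF Z k ij(1)])
qed

text \<open>The inverse of \<open>half_vec\<close>, given by a linear formula instead of a choice,
  so that its entries are visibly continuous in \<open>y\<close>. The index \<open>j * n + i\<close>
  is the position of the entry \<open>(i, j)\<close> after column stacking.\<close>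

definition unhalf :: "nat \<Rightarrow> real vec \<Rightarrow> real mat" where
  "unhalf n y = mat n n (\<lambda>(i, j). (dup_mat n *\<^sub>v y) $ (j * n + i))"

lemma unhalf:
  assumes "y \<in> carrier_vec (half_dim n)"
  shows "unhalf n y \<in> sym_mats n" "half_vec (unhalf n y) = y"
proof -
  obtain X where X: "X \<in> sym_mats n" "half_vec X = y" by (rule half_vec_surj[OF assms])
  note Xc = sym_mats_carrier[OF X(1)]
  have "unhalf n y = X"
  proof (rule eq_matI)
    fix i j assume "i < dim_row X" "j < dim_col X"
    then have ij: "i < n" "j < n" using Xc by auto
    then have "unhalf n y $$ (i, j) = vec_cols X $ (j * n + i)"
      using dup_mat_half_vec[OF X(1)] X(2) by (simp add: unhalf_def)
    also have "\<dots> = X $$ (i, j)"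
      using vec_cols_index[OF Xc mult_add_less_square[OF ij(2,1)]] ij by simp
    finally show "unhalf n y $$ (i, j) = X $$ (i, j)" .
  qed (use Xc in \<open>auto simp: unhalf_def\<close>)
  then show "unhalf n y \<in> sym_mats n" "half_vec (unhalf n y) = y" using X by auto
qed

section \<open>The operator and its matrix\<close>

lemma kron_transpose:
  assumes "A \<in> carrier_mat n n" "B \<in> carrier_mat n n"
  shows "kron (A\<^sup>T) (B\<^sup>T) = (kron A B)\<^sup>T"
  using assms div_mod_less_square[of _ n]
  by (intro eq_matI) (simp_all add: kron_def power2_eq_square)

lemma qf_congruence:
  assumes "A \<in> carrier_mat n n" "X \<in> carrier_mat n n" "v \<in> carrier_vec n"
  shows "qf (A * X * A\<^sup>T) v = qf X (A\<^sup>T *\<^sub>v v)"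
proof -
  have w: "A\<^sup>T *\<^sub>v v \<in> carrier_vec n" using assms by simp
  have "A * X * A\<^sup>T *\<^sub>v v = A *\<^sub>v (X *\<^sub>v (A\<^sup>T *\<^sub>v v))"
    using assms w by (simp add: assoc_mult_mat_vec[of _ n n _ n])
  then show ?thesis
    unfolding qf_def using transpose_vec_mult_scalar[OF assms(1) mult_mat_vec_carrier[OF assms(2) w] assms(3)]
    by simp
qed

text \<open>The results in this locale are applied twice: to the matrices \<open>J i\<close>, and to
  their transposes, whose operator is the adjoint.\<close>

locale completely_positive =
  fixes n N :: nat and J :: "nat \<Rightarrow> real mat"
  assumes J: "\<And>i. i \<le> N \<Longrightarrow> J i \<in> carrier_mat n n"
begin

abbreviation "D \<equiv> D_op n N J"
abbreviation "M \<equiv> M_D n N J"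

lemma summand_carrier:
  "X \<in> carrier_mat n n \<Longrightarrow> i \<in> {0..N} \<Longrightarrow> J i * X * (J i)\<^sup>T \<in> carrier_mat n n"
  using J[of i] by simp

lemma D_carrier: "X \<in> carrier_mat n n \<Longrightarrow> D X \<in> carrier_mat n n"
  unfolding D_op_def using summand_carrier by (intro finsum_mat_carrier) auto

lemma D_index:
  assumes "X \<in> carrier_mat n n" "r < n" "c < n"
  shows "D X $$ (r, c) = (\<Sum>i = 0..N. (J i * X * (J i)\<^sup>T) $$ (r, c))"
  unfolding D_op_def using summand_carrier[OF assms(1)] assms by (intro finsum_mat_index) auto

lemma D_sym:
  assumes "X \<in> sym_mats n"
  shows "D X \<in> sym_mats n"
  unfolding sym_mats_iff
proof (intro conjI allI impI)
  have X: "X \<in> carrier_mat n n" "X\<^sup>T = X" using assms by (auto simp: sym_mats_def)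
  show "D X \<in> carrier_mat n n" using X by (intro D_carrier)
  fix r c assume rc: "r < n" "c < n"
  have "(J i * X * (J i)\<^sup>T) $$ (r, c) = (J i * X * (J i)\<^sup>T) $$ (c, r)" if "i \<in> {0..N}" for i
  proof -
    have Ji: "J i \<in> carrier_mat n n" using that J by simp
    have JX: "J i * X \<in> carrier_mat n n" using Ji X by simp
    have "(J i * X * (J i)\<^sup>T)\<^sup>T = J i * X\<^sup>T * (J i)\<^sup>T"
      unfolding transpose_mult[OF JX transpose_carrier_mat[THEN iffD2, OF Ji]]
        transpose_mult[OF Ji X(1)] transpose_transpose
      using Ji X by (simp add: assoc_mult_mat[of _ n n _ n _ n])
    then have "(J i * X * (J i)\<^sup>T)\<^sup>T = J i * X * (J i)\<^sup>T" using X by simp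
    moreover have "(J i * X * (J i)\<^sup>T)\<^sup>T $$ (c, r) = (J i * X * (J i)\<^sup>T) $$ (r, c)"
      using rc summand_carrier[OF X(1) that] by (intro index_transpose_mat(1)) auto
    ultimately show ?thesis by simp
  qed
  then show "D X $$ (r, c) = D X $$ (c, r)" using rc X by (simp add: D_index)
qed

text \<open>Congruence moves each \<open>J i\<close> onto the vector. Positivity of
  \<open>D\<close>, and later its monotonicity in the Loewner order, follow termwise.\<close>

lemma qf_D:
  assumes "X \<in> carrier_mat n n" "v \<in> carrier_vec n"
  shows "qf (D X) v = (\<Sum>i = 0..N. qf X ((J i)\<^sup>T *\<^sub>v v))"
proof -
  have "qf (D X) v = (\<Sum>i = 0..N. qf (J i * X * (J i)\<^sup>T) v)"
    unfolding D_op_def using summand_carrier[OF assms(1)] assms by (intro qf_finsum_mat) auto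
  also have "\<dots> = (\<Sum>i = 0..N. qf X ((J i)\<^sup>T *\<^sub>v v))"
    using J assms by (intro sum.cong refl qf_congruence) auto
  finally show ?thesis .
qed

lemma J_transpose_mult_carrier: "i \<in> {0..N} \<Longrightarrow> v \<in> carrier_vec n \<Longrightarrow> (J i)\<^sup>T *\<^sub>v v \<in> carrier_vec n"
  using J[of i] by simp

lemma D_psd:
  assumes "X \<in> psd_mats n"
  shows "D X \<in> psd_mats n"
proof -
  have X: "X \<in> sym_mats n" "X \<in> carrier_mat n n" "\<And>v. v \<in> carrier_vec n \<Longrightarrow> qf X v \<ge> 0"
    using assms by (auto simp: psd_mats_iff sym_mats_carrier)
  have "qf (D X) v \<ge> 0" if "v \<in> carrier_vec n" for v
    unfolding qf_D[OF X(2) that] using that by (intro sum_nonneg X(3) J_transpose_mult_carrier)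
  then show ?thesis using D_sym[OF X(1)] by (simp add: psd_mats_iff)
qed

abbreviation "kron_sum \<equiv> finsum_mat (n\<^sup>2) (n\<^sup>2) (\<lambda>i. kron (J i) (J i)) {0..N}"

lemma kron_J_carrier: "i \<in> {0..N} \<Longrightarrow> kron (J i) (J i) \<in> carrier_mat (n\<^sup>2) (n\<^sup>2)"
  using J by (intro kron_carrier) auto

lemma kron_sum_carrier: "kron_sum \<in> carrier_mat (n\<^sup>2) (n\<^sup>2)"
  using kron_J_carrier by (intro finsum_mat_carrier) auto

lemma kron_sum_vec_cols:
  assumes "X \<in> carrier_mat n n"
  shows "kron_sum *\<^sub>v vec_cols X = vec_cols (D X)"
proof (rule eq_vecI)
  show "dim_vec (kron_sum *\<^sub>v vec_cols X) = dim_vec (vec_cols (D X))"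
    using kron_sum_carrier vec_cols_carrier[OF D_carrier[OF assms]] by simp
  fix r assume "r < dim_vec (vec_cols (D X))"
  then have r: "r < n\<^sup>2" using vec_cols_carrier[OF D_carrier[OF assms]] by simp
  have "(kron_sum *\<^sub>v vec_cols X) $ r = (\<Sum>i = 0..N. (kron (J i) (J i) *\<^sub>v vec_cols X) $ r)"
    using kron_J_carrier vec_cols_carrier[OF assms] r by (intro finsum_mat_mult_vec_index) auto
  also have "\<dots> = (\<Sum>i = 0..N. (J i * X * (J i)\<^sup>T) $$ (r mod n, r div n))"
  proof (intro sum.cong refl)
    fix i assume i: "i \<in> {0..N}"
    then have "kron (J i) (J i) *\<^sub>v vec_cols X = vec_cols (J i * X * (J i)\<^sup>T)"
      using J assms by (intro kron_mult_vec_cols) auto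
    then show "(kron (J i) (J i) *\<^sub>v vec_cols X) $ r = (J i * X * (J i)\<^sup>T) $$ (r mod n, r div n)"
      using vec_cols_index[OF summand_carrier[OF assms i] r] by simp
  qed
  also have "\<dots> = D X $$ (r mod n, r div n)"
    by (rule D_index[OF assms div_mod_less_square(2,1)[OF r], symmetric])
  also have "\<dots> = vec_cols (D X) $ r"
    by (rule vec_cols_index[OF D_carrier[OF assms] r, symmetric])
  finally show "(kron_sum *\<^sub>v vec_cols X) $ r = vec_cols (D X) $ r" .
qed

lemma M_carrier: "M \<in> carrier_mat (half_dim n) (half_dim n)"
  unfolding M_D_def using kron_sum_carrier dup_mat_carrier[of n]
  by (meson mult_carrier_mat transpose_carrier_mat)

text \<open>The right factor \<open>dup_mat n\<close> turns \<open>half_vec X\<close> into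
  \<open>vec_cols X\<close>, and the Kronecker sum maps this to \<open>vec_cols (D X)\<close>. As
  \<open>D X\<close> is symmetric, the latter is \<open>dup_mat n\<close> applied to
  \<open>half_vec (D X)\<close>, and orthogonality cancels \<open>dup_mat n\<close> against the left
  factor.\<close>

lemma M_half_vec:
  assumes "X \<in> sym_mats n"
  shows "M *\<^sub>v half_vec X = half_vec (D X)"
proof -
  let ?F = "dup_mat n" and ?h = "half_vec X"
  note F = dup_mat_carrier[of n] and S = kron_sum_carrier
  have X: "X \<in> carrier_mat n n" using assms by (rule sym_mats_carrier)
  have h: "?h \<in> carrier_vec (half_dim n)" using X by (rule half_vec_carrier)
  have Ft: "?F\<^sup>T \<in> carrier_mat (half_dim n) (n\<^sup>2)" using F by simp
  have hD: "half_vec (D X) \<in> carrier_vec (half_dim n)" using X by (intro half_vec_carrier D_carrier)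
  have "M *\<^sub>v ?h = (?F\<^sup>T * kron_sum) *\<^sub>v (?F *\<^sub>v ?h)"
    unfolding M_D_def by (rule assoc_mult_mat_vec[OF mult_carrier_mat[OF Ft S] F h])
  also have "\<dots> = ?F\<^sup>T *\<^sub>v (kron_sum *\<^sub>v (?F *\<^sub>v ?h))"
    by (rule assoc_mult_mat_vec[OF Ft S mult_mat_vec_carrier[OF F h]])
  also have "\<dots> = ?F\<^sup>T *\<^sub>v (?F *\<^sub>v half_vec (D X))"
    unfolding dup_mat_half_vec[OF assms] kron_sum_vec_cols[OF X] dup_mat_half_vec[OF D_sym[OF assms]] ..
  also have "\<dots> = (?F\<^sup>T * ?F) *\<^sub>v half_vec (D X)"
    by (rule assoc_mult_mat_vec[OF Ft F hD, symmetric])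
  also have "\<dots> = half_vec (D X)" unfolding dup_mat_orthogonal using hD by simp
  finally show ?thesis .
qed

lemma D_pow_sym: "X \<in> sym_mats n \<Longrightarrow> (D ^^ k) X \<in> sym_mats n"
  by (induction k) (auto intro: D_sym)

lemma M_pow_half_vec:
  assumes "X \<in> sym_mats n"
  shows "M ^\<^sub>m k *\<^sub>v half_vec X = half_vec ((D ^^ k) X)"
  using assms
proof (induction k arbitrary: X)
  case 0
  then show ?case using M_carrier half_vec_carrier[OF sym_mats_carrier[OF 0]] by simp
next
  case (Suc k)
  have "M ^\<^sub>m Suc k *\<^sub>v half_vec X = M ^\<^sub>m k *\<^sub>v (M *\<^sub>v half_vec X)"
    unfolding pow_mat.simps
    by (rule assoc_mult_mat_vec[OF pow_carrier_mat[OF M_carrier] M_carrier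
          half_vec_carrier[OF sym_mats_carrier[OF Suc.prems]]])
  also have "\<dots> = half_vec ((D ^^ k) (D X))"
    unfolding M_half_vec[OF Suc.prems] by (rule Suc.IH[OF D_sym[OF Suc.prems]])
  finally show ?case by (simp add: funpow_swap1)
qed

lemma transposed: "completely_positive n N (\<lambda>i. (J i)\<^sup>T)"
  using J by unfold_locales simp

text \<open>Transposition commutes with Kronecker products, with sums and with the compression by
  \<open>dup_mat n\<close>. This is the bridge between \<open>D\<close> and its adjoint.\<close>

lemma M_transposed: "M_D n N (\<lambda>i. (J i)\<^sup>T) = M\<^sup>T"
proof -
  let ?F = "dup_mat n"
  let ?S' = "finsum_mat (n\<^sup>2) (n\<^sup>2) (\<lambda>i. kron ((J i)\<^sup>T) ((J i)\<^sup>T)) {0..N}"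
  note F = dup_mat_carrier[of n] and S = kron_sum_carrier
  have Ft: "?F\<^sup>T \<in> carrier_mat (half_dim n) (n\<^sup>2)" using F by simp
  have S': "?S' \<in> carrier_mat (n\<^sup>2) (n\<^sup>2)"
    by (rule completely_positive.kron_sum_carrier[OF transposed])
  have "?S' = kron_sum\<^sup>T"
  proof (rule eq_matI)
    fix r c assume "r < dim_row (kron_sum\<^sup>T)" "c < dim_col (kron_sum\<^sup>T)"
    then have rc: "r < n\<^sup>2" "c < n\<^sup>2" using S by auto
    have "?S' $$ (r, c) = (\<Sum>i = 0..N. kron ((J i)\<^sup>T) ((J i)\<^sup>T) $$ (r, c))"
      using completely_positive.kron_J_carrier[OF transposed] rc by (intro finsum_mat_index) auto
    also have "\<dots> = (\<Sum>i = 0..N. kron (J i) (J i) $$ (c, r))"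
    proof (intro sum.cong refl)
      fix i assume i: "i \<in> {0..N}"
      then have "kron ((J i)\<^sup>T) ((J i)\<^sup>T) = (kron (J i) (J i))\<^sup>T" using J by (intro kron_transpose) auto
      then show "kron ((J i)\<^sup>T) ((J i)\<^sup>T) $$ (r, c) = kron (J i) (J i) $$ (c, r)"
        using kron_J_carrier[OF i] rc by simp
    qed
    also have "\<dots> = kron_sum $$ (c, r)"
      using kron_J_carrier rc by (intro finsum_mat_index[symmetric]) auto
    finally show "?S' $$ (r, c) = kron_sum\<^sup>T $$ (r, c)" using S rc by simp
  qed (use S S' in auto)
  then show ?thesis
    unfolding M_D_def transpose_mult[OF mult_carrier_mat[OF Ft S] F] transpose_mult[OF Ft S] transpose_transpose
    using assoc_mult_mat[OF Ft transpose_carrier_mat[THEN iffD2, OF S] F] by simp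
qed

end

section \<open>The four conditions for a completely positive operator\<close>

lemma continuous_on_det:
  fixes A :: "real \<Rightarrow> real mat"
  assumes A: "\<And>s. A s \<in> carrier_mat m m"
    and "\<And>i j. i < m \<Longrightarrow> j < m \<Longrightarrow> continuous_on S (\<lambda>s. A s $$ (i, j))"
  shows "continuous_on S (\<lambda>s. det (A s))"
  unfolding det_def'[OF A]
proof (intro continuous_intros assms)
  fix p i assume "p \<in> {p. p permutes {0..<m}}" "i \<in> {0..<m}"
  then show "i < m" "p i < m" using permutes_in_image[of p "{0..<m}" i] by auto
qed

text \<open>Each entry of the adjugate is a signed minor, hence a determinant of entries of
  \<open>A s\<close>. This gives continuity of solutions expressed by Cramer's rule.\<close>

lemma continuous_on_adj_mat:
  fixes A :: "real \<Rightarrow> real mat"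
  assumes A: "\<And>s. A s \<in> carrier_mat m m"
    and cont: "\<And>i j. i < m \<Longrightarrow> j < m \<Longrightarrow> continuous_on S (\<lambda>s. A s $$ (i, j))"
    and ij: "i < m" "j < m"
  shows "continuous_on S (\<lambda>s. adj_mat (A s) $$ (i, j))"
proof -
  have "adj_mat (A s) $$ (i, j) = (- 1) ^ (j + i) * det (mat_delete (A s) j i)" for s
    using A[of s] ij by (simp add: adj_mat_def cofactor_def)
  moreover have "continuous_on S (\<lambda>s. det (mat_delete (A s) j i))"
  proof (rule continuous_on_det)
    show "mat_delete (A s) j i \<in> carrier_mat (m - 1) (m - 1)" for s
      using A[of s] by (simp add: mat_delete_def)
    fix k l assume kl: "k < m - 1" "l < m - 1"
    have "mat_delete (A s) j i $$ (k, l)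
        = A s $$ (if k < j then k else Suc k, if l < i then l else Suc l)" for s
      using A[of s] kl by (simp add: mat_delete_def)
    then show "continuous_on S (\<lambda>s. mat_delete (A s) j i $$ (k, l))"
      using kl by (simp add: cont)
  qed
  ultimately show ?thesis by (simp add: continuous_on_mult_left)
qed

text \<open>The neighbourhoods given by \<open>nbh\<close> unite to an open set \<open>U\<close>
  that agrees with \<open>A\<close> on the unit interval. If 1 were missing, \<open>U\<close> and
  the complement of \<open>A\<close> would disconnect the interval.\<close>

lemma one_in_clopen_unit_interval:
  fixes A :: "real set"
  assumes "0 \<in> A" "closed A"
    and nbh: "\<And>s. s \<in> A \<Longrightarrow> s \<in> {0..1} \<Longrightarrow> \<exists>e>0. \<forall>t\<in>{0..1}. \<bar>t - s\<bar> < e \<longrightarrow> t \<in> A"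
  shows "1 \<in> A"
proof -
  obtain e where e: "\<And>s. s \<in> A \<inter> {0..1} \<Longrightarrow> e s > 0 \<and> (\<forall>t\<in>{0..1}. \<bar>t - s\<bar> < e s \<longrightarrow> t \<in> A)"
    using nbh by (metis IntE)
  define U where "U = (\<Union>s\<in>A \<inter> {0..1}. {s - e s<..<s + e s})"
  have U: "open U" unfolding U_def by (intro open_UN ballI open_greaterThanLessThan)
  have in_U: "s \<in> U" if "s \<in> A" "s \<in> {0..1}" for s
    unfolding U_def using that e[of s] by (intro UN_I[of s]) auto
  have U_sub: "t \<in> A" if t: "t \<in> U" "t \<in> {0..1}" for t
  proof -
    obtain s where s: "s \<in> A \<inter> {0..1}" "s - e s < t" "t < s + e s" using t by (auto simp: U_def)
    then have "\<bar>t - s\<bar> < e s" by linarith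
    then show ?thesis using e[OF s(1)] t by blast
  qed
  have "U \<inter> {0..1} = {} \<or> - A \<inter> {0..1} = {}"
    using U_sub in_U by (intro connectedD[OF connected_Icc U open_Compl[OF assms(2)]]) auto
  moreover have "0 \<in> U \<inter> {0..1}" using in_U[of 0] assms(1) by simp
  ultimately show ?thesis by auto
qed

context completely_positive
begin

section \<open>From exponential stability to eigenvalues in the unit disc\<close>

lemma exp_stable_half_vec_tendsto:
  assumes stable: "exp_stable n D" and y: "y \<in> carrier_vec (half_dim n)" and i: "i < half_dim n"
  shows "(\<lambda>k. (M ^\<^sub>m k *\<^sub>v y) $ i) \<longlonglongrightarrow> 0"
proof -
  have psd: "(\<lambda>k. (M ^\<^sub>m k *\<^sub>v half_vec X) $ i) \<longlonglongrightarrow> 0" if X: "X \<in> psd_mats n" for X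
  proof -
    obtain \<beta> \<rho> :: real where \<rho>: "0 < \<rho>" "\<rho> < 1"
      and bound: "\<And>X :: nat \<Rightarrow> real mat. X 0 \<in> psd_mats n \<Longrightarrow> (\<And>k. X (Suc k) = D (X k)) \<Longrightarrow>
        (\<forall>k. spectral_norm (X k) \<le> \<beta> * \<rho> ^ k * spectral_norm (X 0))"
      using stable unfolding exp_stable_def by blast
    have Xs: "X \<in> sym_mats n" using X by (simp add: psd_mats_iff)
    obtain r c where rc: "lower_index n ! i = (r, c)" "c \<le> r" "r < n" "c < n"
      by (rule lower_index_cases[OF i])
    \<comment> \<open>The factor \<open>sqrt 2\<close> covers the weight of an off-diagonal entry in
      \<open>half_vec\<close>.\<close>
    define C where "C = sqrt 2 * \<beta> * spectral_norm X"
    have le: "\<bar>(M ^\<^sub>m k *\<^sub>v half_vec X) $ i\<bar> \<le> C * \<rho> ^ k" for k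
    proof -
      let ?Y = "(D ^^ k) X"
      have Y: "?Y \<in> carrier_mat n n" by (rule sym_mats_carrier[OF D_pow_sym[OF Xs]])
      have "\<bar>(M ^\<^sub>m k *\<^sub>v half_vec X) $ i\<bar> = (if r = c then 1 else sqrt 2) * \<bar>?Y $$ (r, c)\<bar>"
        unfolding M_pow_half_vec[OF Xs] half_vec_index[OF Y i rc(1)] by (simp add: abs_mult)
      also have "\<dots> \<le> sqrt 2 * \<bar>?Y $$ (r, c)\<bar>" by (intro mult_right_mono) auto
      also have "\<dots> \<le> sqrt 2 * spectral_norm ?Y"
        using entry_le_spectral_norm[of r ?Y c] Y rc by (intro mult_left_mono) auto
      also have "\<dots> \<le> sqrt 2 * (\<beta> * \<rho> ^ k * spectral_norm X)"
        using bound[of "\<lambda>k. (D ^^ k) X"] X by (intro mult_left_mono) auto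
      finally show ?thesis by (simp add: C_def mult_ac)
    qed
    have "(\<lambda>k. C * \<rho> ^ k) \<longlonglongrightarrow> 0"
      using \<rho> by (intro tendsto_mult_right_zero LIMSEQ_realpow_zero) auto
    moreover have "norm ((M ^\<^sub>m k *\<^sub>v half_vec X) $ i) \<le> norm (C * \<rho> ^ k) * 1" for k
      unfolding real_norm_def mult_1_right by (rule order.trans[OF le abs_ge_self])
    ultimately show ?thesis by (rule tendsto_0_le[OF _ always_eventually[OF allI]])
  qed
  obtain X where X: "X \<in> sym_mats n" "half_vec X = y" by (rule half_vec_surj[OF y])
  \<comment> \<open>Stability speaks only of positive semidefinite initial values. A symmetric
    \<open>X\<close> is the difference of \<open>X + c I\<close> and \<open>c I\<close>, both
    positive semidefinite for this \<open>c\<close>, and linearity of the powers of \<open>M\<close>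
    extends the limit to \<open>X\<close>.\<close>
  define c where "c = entry_sum X"
  note Xc = sym_mats_carrier[OF X(1)]
  have I: "1\<^sub>m n \<in> psd_mats n" by (rule pd_mats_psd[OF pd_mats_one])
  have cI: "c \<cdot>\<^sub>m 1\<^sub>m n \<in> sym_mats n" by (rule sym_mats_smult[OF sym_mats_one])
  have XcI: "X + c \<cdot>\<^sub>m 1\<^sub>m n \<in> psd_mats n"
    unfolding psd_mats_iff
  proof (intro conjI ballI sym_mats_add[OF X(1) cI])
    fix v :: "real vec" assume v: "v \<in> carrier_vec n"
    have "qf (X + c \<cdot>\<^sub>m 1\<^sub>m n) v = qf X v + c * (v \<bullet> v)"
      using v Xc qf_add[OF Xc sym_mats_carrier[OF cI] v] by (simp add: qf_smult[of _ n] qf_one)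
    then show "qf (X + c \<cdot>\<^sub>m 1\<^sub>m n) v \<ge> 0" using qf_abs_le[OF Xc v] by (simp add: c_def)
  qed
  have hI: "half_vec (1\<^sub>m n) \<in> carrier_vec (half_dim n)" by (rule half_vec_carrier) simp
  have "half_vec (X + c \<cdot>\<^sub>m 1\<^sub>m n) = y + c \<cdot>\<^sub>v half_vec (1\<^sub>m n)"
    unfolding half_vec_add[OF Xc sym_mats_carrier[OF cI]] half_vec_smult[OF sym_mats_carrier[OF sym_mats_one]] X(2) ..
  moreover have "(M ^\<^sub>m k *\<^sub>v (y + c \<cdot>\<^sub>v half_vec (1\<^sub>m n))) $ i
      = (M ^\<^sub>m k *\<^sub>v y) $ i + c * (M ^\<^sub>m k *\<^sub>v half_vec (1\<^sub>m n)) $ i" for k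
  proof -
    have Mk: "M ^\<^sub>m k \<in> carrier_mat (half_dim n) (half_dim n)" by (rule pow_carrier_mat[OF M_carrier])
    have chI: "c \<cdot>\<^sub>v half_vec (1\<^sub>m n) \<in> carrier_vec (half_dim n)" using hI by simp
    show ?thesis
      unfolding mult_add_distrib_mat_vec[OF Mk y chI] mult_mat_vec[OF Mk hI]
      using Mk M_carrier i by (simp del: index_mult_mat_vec)
  qed
  ultimately have "(M ^\<^sub>m k *\<^sub>v y) $ i
      = (M ^\<^sub>m k *\<^sub>v half_vec (X + c \<cdot>\<^sub>m 1\<^sub>m n)) $ i - c * (M ^\<^sub>m k *\<^sub>v half_vec (1\<^sub>m n)) $ i" for k
    by simp
  moreover have "(\<lambda>k. (M ^\<^sub>m k *\<^sub>v half_vec (X + c \<cdot>\<^sub>m 1\<^sub>m n)) $ i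
      - c * (M ^\<^sub>m k *\<^sub>v half_vec (1\<^sub>m n)) $ i) \<longlonglongrightarrow> 0 - c * 0"
    by (intro tendsto_intros psd XcI I)
  ultimately show ?thesis by simp
qed

text \<open>Applied to unit vectors, the preceding limit makes the powers of \<open>M\<close> tend
  to 0 entrywise. For a complex eigenvector \<open>v\<close> with \<open>v $ i\<close> nonzero,
  \<open>z ^ k * v $ i\<close> then tends to 0, whereas its modulus would stay at least that of
  \<open>v $ i\<close> if \<open>cmod z\<close> were at least 1.\<close>

lemma exp_stable_imp_schur_stable:
  assumes "exp_stable n D"
  shows "schur_stable M"
  unfolding schur_stable_def
proof
  fix z assume "z \<in> spectrum (cplx_mat M)"
  then obtain v where v: "eigenvector (cplx_mat M) v z"
    by (auto simp: spectrum_def eigenvalue_def)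
  let ?m = "half_dim n"
  have Mc: "cplx_mat M \<in> carrier_mat ?m ?m" using M_carrier by simp
  have vc: "v \<in> carrier_vec ?m" and v0: "v \<noteq> 0\<^sub>v ?m" using v Mc by (auto simp: eigenvector_def)
  obtain i where i: "i < ?m" "v $ i \<noteq> 0" using vc v0 by (metis carrier_vecD eq_vecI index_zero_vec)
  have pow: "z ^ k * v $ i = (\<Sum>j<?m. of_real ((M ^\<^sub>m k) $$ (i, j)) * v $ j)" for k
  proof -
    have Mk: "M ^\<^sub>m k \<in> carrier_mat ?m ?m" by (rule pow_carrier_mat[OF M_carrier])
    have "z ^ k * v $ i = (z ^ k \<cdot>\<^sub>v v) $ i" using i vc by simp
    also have "z ^ k \<cdot>\<^sub>v v = cplx_mat (M ^\<^sub>m k) *\<^sub>v v"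
      unfolding of_real_hom.mat_hom_pow[OF M_carrier] eigenvector_pow[OF Mc v] ..
    also have "(cplx_mat (M ^\<^sub>m k) *\<^sub>v v) $ i = (\<Sum>j<?m. of_real ((M ^\<^sub>m k) $$ (i, j)) * v $ j)"
      using i vc Mk M_carrier by (simp add: scalar_prod_def atLeast0LessThan)
    finally show ?thesis .
  qed
  have entry: "(\<lambda>k. (M ^\<^sub>m k) $$ (i, j)) \<longlonglongrightarrow> 0" if "j < ?m" for j
  proof -
    have "(M ^\<^sub>m k *\<^sub>v unit_vec ?m j) $ i = (M ^\<^sub>m k) $$ (i, j)" for k
      using pow_carrier_mat[OF M_carrier, of k] M_carrier i that by simp
    with exp_stable_half_vec_tendsto[OF assms _ i(1), of "unit_vec ?m j"] show ?thesis by simp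
  qed
  have "(\<lambda>k. \<Sum>j<?m. complex_of_real ((M ^\<^sub>m k) $$ (i, j)) * v $ j) \<longlonglongrightarrow> (\<Sum>j<?m. of_real 0 * v $ j)"
    by (intro tendsto_intros entry) simp
  then have "(\<lambda>k. z ^ k * v $ i) \<longlonglongrightarrow> 0" by (simp add: pow)
  then have lim: "(\<lambda>k. cmod (z ^ k * v $ i)) \<longlonglongrightarrow> 0" by (rule tendsto_norm_zero)
  show "z \<in> unit_disc"
  proof (rule ccontr)
    assume "z \<notin> unit_disc"
    then have "cmod (v $ i) \<le> cmod (z ^ k * v $ i)" for k
      by (simp add: norm_mult norm_power mult_le_cancel_right1 one_le_power)
    then have "cmod (v $ i) \<le> 0" by (intro LIMSEQ_le_const[OF lim]) auto
    then show False using i by simp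
  qed
qed

text \<open>An eigenvalue with a real eigenmatrix is itself real, as the quotient of two real
  entries at a position where \<open>X\<close> is nonzero. Hence \<open>half_vec X\<close> is an
  eigenvector of \<open>M\<close>, nonzero by injectivity.\<close>

lemma schur_stable_imp_sp:
  assumes "schur_stable M"
  shows "sp n D \<subseteq> unit_disc"
proof
  fix z assume "z \<in> sp n D"
  then obtain X where X: "X \<in> sym_mats n" "X \<noteq> 0\<^sub>m n n" and eq: "cplx_mat (D X) = z \<cdot>\<^sub>m cplx_mat X"
    by (auto simp: sp_def)
  note Xc = sym_mats_carrier[OF X(1)]
  have entry: "complex_of_real (D X $$ (i, j)) = z * of_real (X $$ (i, j))" if "i < n" "j < n" for i j
  proof -
    have "cplx_mat (D X) $$ (i, j) = (z \<cdot>\<^sub>m cplx_mat X) $$ (i, j)" by (simp only: eq)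
    then show ?thesis using that Xc D_carrier[OF Xc] by simp
  qed
  obtain i j where ij: "i < n" "j < n" "X $$ (i, j) \<noteq> 0"
    using X(2) Xc by (metis carrier_matD eq_matI index_zero_mat)
  define l where "l = D X $$ (i, j) / X $$ (i, j)"
  have z: "z = of_real l" using entry[OF ij(1,2)] ij by (simp add: l_def field_simps)
  have "D X = l \<cdot>\<^sub>m X"
  proof (rule eq_matI)
    fix r c assume "r < dim_row (l \<cdot>\<^sub>m X)" "c < dim_col (l \<cdot>\<^sub>m X)"
    then have rc: "r < n" "c < n" using Xc by auto
    from entry[OF this] have "complex_of_real (D X $$ (r, c)) = of_real (l * X $$ (r, c))" by (simp add: z)
    then show "D X $$ (r, c) = (l \<cdot>\<^sub>m X) $$ (r, c)" using rc Xc by (simp only: of_real_eq_iff) simp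
  qed (use Xc D_carrier[OF Xc] in auto)
  then have Mh: "M *\<^sub>v half_vec X = l \<cdot>\<^sub>v half_vec X"
    using M_half_vec[OF X(1)] half_vec_smult[OF Xc] by simp
  have h: "half_vec X \<in> carrier_vec (half_dim n)" by (rule half_vec_carrier[OF Xc])
  have h0: "half_vec X \<noteq> 0\<^sub>v (half_dim n)"
  proof
    assume "half_vec X = 0\<^sub>v (half_dim n)"
    then have "half_vec X = half_vec (0\<^sub>m n n)" by (simp only: half_vec_zero)
    then have "X = 0\<^sub>m n n" by (rule half_vec_inj[OF X(1), rotated]) (simp add: sym_mats_iff)
    then show False using X(2) by simp
  qed
  have "eigenvector M (half_vec X) l" using M_carrier h h0 Mh by (simp add: eigenvector_def)
  then have "eigenvalue (cplx_mat M) z"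
    unfolding z eigenvalue_def by (blast intro: of_real_hom.eigenvector_hom[OF M_carrier])
  then show "z \<in> unit_disc" using assms unfolding schur_stable_def spectrum_def by blast
qed

section \<open>Solving the Lyapunov equation by continuation\<close>

text \<open>Since \<open>sp n D\<close> only sees real symmetric eigenvectors, complex eigenvalues must be excluded by
  positivity. The solution \<open>P s\<close> of \<open>P = s D(P) + I\<close> exists for all \<open>s \<in> [0, 1]\<close>, as \<open>1 / s\<close> is no
  eigenvalue. The set of \<open>s\<close> with \<open>P s\<close> positive semidefinite is closed, and it is open because
  \<open>P s\<close> is then bounded below by \<open>I\<close>. It contains 0, hence also 1.\<close>

lemma sp_imp_lyapunov:
  assumes sp: "sp n D \<subseteq> unit_disc"
  obtains P where "P \<in> pd_mats n" "D P - P + 1\<^sub>m n = 0\<^sub>m n n"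
proof -
  let ?m = "half_dim n"
  define h where "h = half_vec (1\<^sub>m n)"
  \<comment> \<open>\<open>K s\<close> represents the map from \<open>X\<close> to
    \<open>X - s D(X)\<close>, and \<open>y s\<close> is Cramer's solution of
    \<open>K s *\<^sub>v y = h\<close>. Where the determinant vanishes, division by 0 makes
    \<open>y s\<close> zero, so \<open>P s\<close> is symmetric for every real
    \<open>s\<close>.\<close>
  define K where "K s = 1\<^sub>m ?m - s \<cdot>\<^sub>m M" for s
  define y where "y s = (1 / det (K s)) \<cdot>\<^sub>v (adj_mat (K s) *\<^sub>v h)" for s
  define P where "P s = unhalf n (y s)" for s
  have h: "h \<in> carrier_vec ?m" unfolding h_def by (rule half_vec_carrier) simp
  have K: "K s \<in> carrier_mat ?m ?m" for s using M_carrier by (simp add: K_def minus_carrier_mat)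
  have adj: "adj_mat (K s) \<in> carrier_mat ?m ?m" for s by (rule adj_mat(1)[OF K])
  have y: "y s \<in> carrier_vec ?m" for s
    unfolding y_def using mult_mat_vec_carrier[OF adj h] by simp
  have P: "P s \<in> sym_mats n" "half_vec (P s) = y s" for s
    unfolding P_def by (rule unhalf[OF y])+
  have Pc: "P s \<in> carrier_mat n n" for s by (rule sym_mats_carrier[OF P(1)])
  have K_mult: "K s *\<^sub>v half_vec X = half_vec X - s \<cdot>\<^sub>v half_vec (D X)" if X: "X \<in> sym_mats n" for s X
  proof -
    have hX: "half_vec X \<in> carrier_vec ?m" by (rule half_vec_carrier[OF sym_mats_carrier[OF X]])
    have "K s *\<^sub>v half_vec X = 1\<^sub>m ?m *\<^sub>v half_vec X - (s \<cdot>\<^sub>m M) *\<^sub>v half_vec X"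
      unfolding K_def using M_carrier hX by (intro minus_mult_distrib_mat_vec[of _ ?m ?m]) auto
    also have "(s \<cdot>\<^sub>m M) *\<^sub>v half_vec X = s \<cdot>\<^sub>v (M *\<^sub>v half_vec X)"
      using M_carrier hX by (intro eq_vecI) auto
    finally show ?thesis using hX M_half_vec[OF X] by simp
  qed
  have split: "u = s \<cdot>\<^sub>v w + h'" if "u - s \<cdot>\<^sub>v w = h'" "u \<in> carrier_vec ?m" "w \<in> carrier_vec ?m"
    for u w h' :: "real vec" and s
    using that by (intro eq_vecI) (auto simp flip: that(1))
  have hD: "half_vec (D X) \<in> carrier_vec ?m" if "X \<in> sym_mats n" for X
    by (rule half_vec_carrier[OF D_carrier[OF sym_mats_carrier[OF that]]])
  \<comment> \<open>A kernel vector would be a nonzero symmetric \<open>X\<close> with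
    \<open>X = s D(X)\<close>. Then \<open>s\<close> is nonzero and \<open>1 / s\<close>, which is
    at least 1, belongs to \<open>sp n D\<close>.\<close>
  have det: "det (K s) \<noteq> 0" if s: "s \<in> {0..1}" for s
  proof
    assume "det (K s) = 0"
    then obtain x where x: "x \<in> carrier_vec ?m" "x \<noteq> 0\<^sub>v ?m" "K s *\<^sub>v x = 0\<^sub>v ?m"
      using det_0_iff_vec_prod_zero_field[OF K] by blast
    obtain X where X: "X \<in> sym_mats n" "half_vec X = x" by (rule half_vec_surj[OF x(1)])
    note Xc = sym_mats_carrier[OF X(1)]
    have "half_vec X = s \<cdot>\<^sub>v half_vec (D X) + 0\<^sub>v ?m"
      using K_mult[OF X(1)] x X hD[OF X(1)] by (intro split) auto
    also have "\<dots> = half_vec (s \<cdot>\<^sub>m D X)"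
      using half_vec_smult[OF D_carrier[OF Xc]] hD[OF X(1)] by simp
    finally have XD: "X = s \<cdot>\<^sub>m D X"
      by (rule half_vec_inj[OF X(1) sym_mats_smult[OF D_sym[OF X(1)]]])
    have X0: "X \<noteq> 0\<^sub>m n n" using x X half_vec_zero by metis
    have entry: "X $$ (i, j) = s * D X $$ (i, j)" if "i < n" "j < n" for i j
      using arg_cong[OF XD, of "\<lambda>A. A $$ (i, j)"] that D_carrier[OF Xc] by simp
    have s0: "s \<noteq> 0"
    proof
      assume "s = 0"
      then have "X = 0\<^sub>m n n" using entry Xc by (intro eq_matI) auto
      then show False using X0 by simp
    qed
    have "cplx_mat (D X) = of_real (1 / s) \<cdot>\<^sub>m cplx_mat X"
      using Xc D_carrier[OF Xc] entry s0 by (intro eq_matI) auto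
    then have "complex_of_real (1 / s) \<in> sp n D" using X X0 unfolding sp_def by blast
    then have "cmod (of_real (1 / s)) < 1" using sp by blast
    then show False using s s0 by (simp add: norm_divide field_simps)
  qed
  have P_eq: "P s = s \<cdot>\<^sub>m D (P s) + 1\<^sub>m n" if s: "s \<in> {0..1}" for s
  proof (rule half_vec_inj[OF P(1) sym_mats_add[OF sym_mats_smult[OF D_sym[OF P(1)]] sym_mats_one]])
    have "K s *\<^sub>v y s = (1 / det (K s)) \<cdot>\<^sub>v (K s *\<^sub>v (adj_mat (K s) *\<^sub>v h))"
      unfolding y_def by (rule mult_mat_vec[OF K mult_mat_vec_carrier[OF adj h]])
    also have "K s *\<^sub>v (adj_mat (K s) *\<^sub>v h) = (K s * adj_mat (K s)) *\<^sub>v h"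
      by (rule assoc_mult_mat_vec[OF K adj h, symmetric])
    also have "\<dots> = det (K s) \<cdot>\<^sub>v h"
      unfolding adj_mat(2)[OF K] using h by (intro eq_vecI) auto
    finally have "K s *\<^sub>v y s = h" using det[OF s] h by (intro eq_vecI) auto
    then have "half_vec (P s) - s \<cdot>\<^sub>v half_vec (D (P s)) = h"
      using K_mult[OF P(1), of s s] P(2) by simp
    then have "half_vec (P s) = s \<cdot>\<^sub>v half_vec (D (P s)) + h"
      using y P(2) hD[OF P(1)] by (intro split) auto
    also have "\<dots> = half_vec (s \<cdot>\<^sub>m D (P s) + 1\<^sub>m n)"
      unfolding h_def half_vec_smult[OF D_carrier[OF Pc], symmetric]
      using D_carrier[OF Pc] by (intro half_vec_add[symmetric]) auto
    finally show "half_vec (P s) = half_vec (s \<cdot>\<^sub>m D (P s) + 1\<^sub>m n)" .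
  qed
  have qf_P: "qf (P s) v = s * qf (D (P s)) v + v \<bullet> v" if "s \<in> {0..1}" "v \<in> carrier_vec n" for s v
  proof -
    have DP: "D (P s) \<in> carrier_mat n n" by (rule D_carrier[OF Pc])
    have "qf (P s) v = qf (s \<cdot>\<^sub>m D (P s) + 1\<^sub>m n) v" using P_eq[OF that(1)] by simp
    also have "\<dots> = qf (s \<cdot>\<^sub>m D (P s)) v + qf (1\<^sub>m n) v" using DP that by (intro qf_add) auto
    finally show ?thesis using qf_smult[OF DP that(2)] qf_one[OF that(2)] by simp
  qed
  \<comment> \<open>Positivity improves itself: if \<open>P s\<close> is positive semidefinite, so
    is \<open>s D(P s)\<close>, and \<open>P s\<close> dominates the identity. This margin is what
    makes the set \<open>A\<close> below relatively open.\<close>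
  have qf_P_ge: "qf (P s) v \<ge> v \<bullet> v" if "P s \<in> psd_mats n" "s \<in> {0..1}" "v \<in> carrier_vec n" for s v
    using qf_P[OF that(2,3)] D_psd[OF that(1)] that by (simp add: psd_mats_iff)
  have cont_K: "continuous_on {0..1} (\<lambda>s. K s $$ (i, j))" if "i < ?m" "j < ?m" for i j
  proof -
    have "K s $$ (i, j) = 1\<^sub>m ?m $$ (i, j) - s * M $$ (i, j)" for s
      unfolding K_def using M_carrier that by simp
    then show ?thesis by (simp add: continuous_intros)
  qed
  have cont_y: "continuous_on {0..1} (\<lambda>s. y s $ i)" if i: "i < ?m" for i
  proof -
    have "y s $ i = (1 / det (K s)) * (\<Sum>j<?m. adj_mat (K s) $$ (i, j) * h $ j)" for s
      unfolding y_def using i adj[of s] h by (simp add: scalar_prod_def atLeast0LessThan)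
    moreover have "continuous_on {0..1} (\<lambda>s. (1 / det (K s)) * (\<Sum>j<?m. adj_mat (K s) $$ (i, j) * h $ j))"
      using det i by (intro continuous_intros continuous_on_det[OF K] continuous_on_adj_mat[OF K] cont_K) auto
    ultimately show ?thesis by simp
  qed
  have cont_P: "continuous_on {0..1} (\<lambda>s. P s $$ (i, j))" if ij: "i < n" "j < n" for i j
  proof -
    have "P s $$ (i, j) = (\<Sum>k<?m. dup_mat n $$ (j * n + i, k) * y s $ k)" for s
      unfolding P_def unhalf_def using ij y[of s] dup_mat_carrier[of n] mult_add_less_square[OF ij(2,1)]
      by (simp add: scalar_prod_def atLeast0LessThan)
    moreover have "continuous_on {0..1} (\<lambda>s. \<Sum>k<?m. dup_mat n $$ (j * n + i, k) * y s $ k)"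
      by (intro continuous_intros cont_y) auto
    ultimately show ?thesis by simp
  qed
  define A where "A = {s \<in> {0..1}. P s \<in> psd_mats n}"
  have cont_qf: "continuous_on {0..1} (\<lambda>s. qf (P s) v)" if "v \<in> carrier_vec n" for v
    unfolding qf_sum[OF Pc that] by (intro continuous_intros cont_P) auto
  have A_eq: "A = {0..1} \<inter> (\<Inter>v\<in>carrier_vec n. (\<lambda>s. qf (P s) v) -` {0..} \<inter> {0..1})"
    using P(1) by (auto simp: A_def psd_mats_iff)
  have closed_v: "closed ((\<lambda>s. qf (P s) v) -` {0..} \<inter> {0..1})" if "v \<in> carrier_vec n" for v
    using cont_qf[OF that] continuous_on_closed_vimage[OF closed_atLeastAtMost] closed_atLeast by blast
  have closed: "closed A"
    unfolding A_eq by (intro closed_Int[OF closed_atLeastAtMost] closed_INT ballI closed_v)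
  have nbh: "\<exists>e>0. \<forall>t\<in>{0..1}. \<bar>t - s\<bar> < e \<longrightarrow> t \<in> A" if s: "s \<in> A" for s
  proof -
    have sA: "s \<in> {0..1}" "P s \<in> psd_mats n" using s by (auto simp: A_def)
    \<comment> \<open>\<open>g\<close> measures the distance to \<open>P s\<close>. Where
      \<open>g t < 1\<close>, the quadratic form changes by at most \<open>v \<bullet> v\<close>,
      which the margin from \<open>qf_P_ge\<close> absorbs.\<close>
    define g where "g t = entry_sum (P t - P s)" for t
    have g: "g t = (\<Sum>i<n. \<Sum>j<n. \<bar>P t $$ (i, j) - P s $$ (i, j)\<bar>)" for t
      unfolding g_def entry_sum_def using Pc[of t] Pc[of s] by simp
    have gs: "g s = 0" unfolding g by simp
    have "continuous_on {0..1} g"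
      unfolding g by (intro continuous_intros cont_P) auto
    then have "(g \<longlongrightarrow> g s) (at s within {0..1})" using sA(1) by (auto simp: continuous_on_def)
    from tendstoD[OF this less_numeral_extra(1)]
    obtain e where e: "e > 0"
        "\<And>t. t \<in> {0..1} \<Longrightarrow> t \<noteq> s \<Longrightarrow> \<bar>t - s\<bar> < e \<Longrightarrow> \<bar>g t\<bar> < 1"
      unfolding eventually_at dist_real_def gs by auto
    have g_less: "g t < 1" if "t \<in> {0..1}" "\<bar>t - s\<bar> < e" for t
      using e(2)[of t] that gs by (cases "t = s") auto
    have "t \<in> A" if t: "t \<in> {0..1}" "\<bar>t - s\<bar> < e" for t
    proof -
      have "qf (P t) v \<ge> 0" if v: "v \<in> carrier_vec n" for v
      proof -
        have "\<bar>qf (P t) v - qf (P s) v\<bar> \<le> g t * (v \<bullet> v)"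
          unfolding g_def qf_diff[OF Pc Pc v, symmetric]
          by (rule qf_abs_le[OF minus_carrier_mat[OF Pc] v])
        also have "\<dots> \<le> 1 * (v \<bullet> v)"
          using g_less[OF t] scalar_prod_self_nonneg[of v] by (intro mult_right_mono) auto
        finally show ?thesis using qf_P_ge[OF sA(2,1) v] by linarith
      qed
      then show ?thesis using t P(1) by (auto simp: A_def psd_mats_iff)
    qed
    then show ?thesis using e(1) by blast
  qed
  \<comment> \<open>At \<open>s = 0\<close> the equation reduces to \<open>P 0 = I\<close>.\<close>
  have "P 0 \<in> psd_mats n"
    unfolding psd_mats_iff using P(1) qf_P[of 0] scalar_prod_self_nonneg by simp
  then have "1 \<in> A" using nbh by (intro one_in_clopen_unit_interval closed) (auto simp: A_def)
  then have P1: "P 1 \<in> psd_mats n" by (simp add: A_def)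
  show thesis
  proof
    have "qf (P 1) v > 0" if "v \<in> carrier_vec n" "v \<noteq> 0\<^sub>v n" for v
      using qf_P_ge[OF P1 _ that(1)] scalar_prod_self_pos[OF that] by simp
    then show "P 1 \<in> pd_mats n" using P(1) by (simp add: pd_mats_iff)
    have DP: "D (P 1) \<in> carrier_mat n n" by (rule D_carrier[OF Pc])
    have P1_eq: "P 1 = 1 \<cdot>\<^sub>m D (P 1) + 1\<^sub>m n" by (rule P_eq) simp
    have "P 1 $$ (i, j) = D (P 1) $$ (i, j) + 1\<^sub>m n $$ (i, j)" if "i < n" "j < n" for i j
      using arg_cong[OF P1_eq, of "\<lambda>A. A $$ (i, j)"] that DP by simp
    then show "D (P 1) - P 1 + 1\<^sub>m n = 0\<^sub>m n n"
      using DP Pc[of 1] by (intro eq_matI) auto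
  qed
qed

section \<open>From a Lyapunov equation to exponential decay\<close>

lemma lyapunov_imp_exp_stable:
  assumes P: "P \<in> pd_mats n" and Q: "Q \<in> pd_mats n" and eq: "D P - P + Q = 0\<^sub>m n n"
  shows "exp_stable n D"
proof -
  have Pc: "P \<in> carrier_mat n n" and Qc: "Q \<in> carrier_mat n n"
    using P Q by (auto simp: pd_mats_iff sym_mats_carrier)
  have Ppsd: "P \<in> psd_mats n" by (rule pd_mats_psd[OF P])
  have DP: "D P \<in> carrier_mat n n" by (rule D_carrier[OF Pc])
  obtain p where p: "p > 0" "\<And>v. v \<in> carrier_vec n \<Longrightarrow> qf P v \<ge> p * (v \<bullet> v)"
    using pd_mats_lower_bound[OF P] by blast
  obtain q where q: "q > 0" "\<And>v. v \<in> carrier_vec n \<Longrightarrow> qf Q v \<ge> q * (v \<bullet> v)"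
    using pd_mats_lower_bound[OF Q] by blast
  define C where "C = entry_sum P + 1"
  have C: "C > 0" using entry_sum_nonneg[of P] by (simp add: C_def)
  have P_le: "qf P v \<le> C * (v \<bullet> v)" if "v \<in> carrier_vec n" for v
    using qf_abs_le[OF Pc that] scalar_prod_self_nonneg[of v] by (simp add: C_def distrib_right)
  \<comment> \<open>Since \<open>Q\<close> dominates \<open>q I\<close> and \<open>C I\<close>
    dominates \<open>P\<close>, \<open>Q\<close> dominates \<open>(q / C) P\<close>, which gives the
    factor \<open>1 - q / C\<close>. The maximum with \<open>1 / 2\<close> secures
    \<open>0 < \<rho>\<close>.\<close>
  define \<rho> where "\<rho> = max (1 / 2) (1 - q / C)"
  have \<rho>: "0 < \<rho>" "\<rho> < 1" using q C by (auto simp: \<rho>_def)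
  have contract: "qf (D P) v \<le> \<rho> * qf P v" if v: "v \<in> carrier_vec n" for v
  proof -
    have "qf (D P - P + Q) v = qf (D P) v - qf P v + qf Q v"
      using DP Pc Qc v by (simp add: qf_add[of _ n] qf_diff[of _ n] minus_carrier_mat)
    moreover have "qf (D P - P + Q) v = 0"
      unfolding eq using v by (simp add: qf_sum[of _ n])
    ultimately have "qf (D P) v = qf P v - qf Q v" by simp
    also have "\<dots> \<le> qf P v - q / C * qf P v"
    proof -
      have "q / C * qf P v \<le> q / C * (C * (v \<bullet> v))"
        using P_le[OF v] q C by (intro mult_left_mono) auto
      also have "\<dots> \<le> qf Q v" using q(2)[OF v] C by simp
      finally show ?thesis by simp
    qed
    also have "\<dots> = (1 - q / C) * qf P v" by (simp add: algebra_simps)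
    also have "\<dots> \<le> \<rho> * qf P v"
      using Ppsd v by (intro mult_right_mono) (auto simp: \<rho>_def psd_mats_iff)
    finally show ?thesis .
  qed
  \<comment> \<open>One factor \<open>n ^ 2\<close> comes from summing the entries of
    \<open>X k\<close>, another from bounding \<open>entry_sum (X 0)\<close> by the spectral norm;
    \<open>C / p\<close> compares \<open>P\<close> with the identity from both sides.\<close>
  define \<beta> where "\<beta> = max 1 (real n ^ 4 * C / p)"
  have "spectral_norm (X k) \<le> \<beta> * \<rho> ^ k * spectral_norm (X 0)"
    if X0: "X 0 \<in> psd_mats n" and step: "\<And>k. X (Suc k) = D (X k)" for X :: "nat \<Rightarrow> real mat" and k
  proof -
    have X0c: "X 0 \<in> carrier_mat n n" using X0 by (simp add: psd_mats_iff sym_mats_carrier)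
    \<comment> \<open>Chosen so that \<open>a P\<close> dominates \<open>X 0\<close>: the form of
      \<open>X 0\<close> is at most \<open>entry_sum (X 0)\<close> times that of the identity, and
      \<open>P\<close> dominates \<open>p I\<close>.\<close>
    define a where "a = entry_sum (X 0) / p"
    have a: "a \<ge> 0" using p entry_sum_nonneg by (simp add: a_def)
    have decay: "X k \<in> psd_mats n \<and> (\<forall>v\<in>carrier_vec n. qf (X k) v \<le> a * \<rho> ^ k * qf P v)" for k
    proof (induction k)
      case 0
      have "qf (X 0) v \<le> a * qf P v" if v: "v \<in> carrier_vec n" for v
      proof -
        have "qf (X 0) v \<le> entry_sum (X 0) * (v \<bullet> v)" using qf_abs_le[OF X0c v] by simp
        also have "\<dots> = a * (p * (v \<bullet> v))" using p by (simp add: a_def)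
        also have "\<dots> \<le> a * qf P v" using a p(2)[OF v] by (intro mult_left_mono)
        finally show ?thesis .
      qed
      then show ?case using X0 by simp
    next
      case (Suc k)
      have Xk: "X k \<in> carrier_mat n n" using Suc by (simp add: psd_mats_iff sym_mats_carrier)
      have "qf (D (X k)) v \<le> a * \<rho> ^ Suc k * qf P v" if v: "v \<in> carrier_vec n" for v
      proof -
        \<comment> \<open>Monotonicity of \<open>D\<close>: the induction hypothesis is used at each
          vector \<open>(J i)\<^sup>T *\<^sub>v v\<close>, and the resulting bounds are collected
          into \<open>D P\<close>.\<close>
        have "qf (D (X k)) v \<le> (\<Sum>i = 0..N. a * \<rho> ^ k * qf P ((J i)\<^sup>T *\<^sub>v v))"
          unfolding qf_D[OF Xk v] using Suc J_transpose_mult_carrier[OF _ v] by (intro sum_mono) auto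
        also have "\<dots> = a * \<rho> ^ k * qf (D P) v" unfolding qf_D[OF Pc v] sum_distrib_left ..
        also have "\<dots> \<le> a * \<rho> ^ k * (\<rho> * qf P v)"
          using a \<rho> contract[OF v] by (intro mult_left_mono) auto
        finally show ?thesis by (simp add: mult_ac)
      qed
      then show ?case using Suc D_psd by (simp add: step)
    qed
    have Xk: "X k \<in> psd_mats n" "X k \<in> carrier_mat n n"
      using decay[of k] by (auto simp: psd_mats_iff sym_mats_carrier)
    have entry: "\<bar>X k $$ (i, j)\<bar> \<le> a * \<rho> ^ k * C" if "i < n" "j < n" for i j
    proof (rule psd_entry_le[OF Xk(1) _ that])
      fix v :: "real vec" assume v: "v \<in> carrier_vec n"
      have "qf (X k) v \<le> a * \<rho> ^ k * qf P v" using decay[of k] v by blast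
      also have "\<dots> \<le> a * \<rho> ^ k * (C * (v \<bullet> v))"
        using a \<rho> P_le[OF v] by (intro mult_left_mono) auto
      finally show "qf (X k) v \<le> a * \<rho> ^ k * C * (v \<bullet> v)" by (simp add: mult_ac)
    qed
    have X0_sum: "entry_sum (X 0) \<le> real n ^ 2 * spectral_norm (X 0)"
    proof -
      have "entry_sum (X 0) \<le> (\<Sum>i<n. \<Sum>j<n. spectral_norm (X 0))"
        unfolding entry_sum_def carrier_matD[OF X0c] using X0c
        by (intro sum_mono entry_le_spectral_norm) auto
      then show ?thesis by (simp add: power2_eq_square mult.assoc)
    qed
    have norm0: "spectral_norm (X 0) \<ge> 0"
      using order.trans[OF real_sqrt_ge_zero norm_mult_le_spectral_norm[of "0\<^sub>v n" "X 0"]] X0c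
      by (simp add: scalar_prod_self_nonneg)
    have "spectral_norm (X k) \<le> entry_sum (X k)" by (rule spectral_norm_le_entry_sum)
    also have "\<dots> \<le> (\<Sum>i<n. \<Sum>j<n. a * \<rho> ^ k * C)"
      unfolding entry_sum_def carrier_matD[OF Xk(2)] by (intro sum_mono entry) auto
    also have "\<dots> = (real n ^ 2 * \<rho> ^ k * C / p) * entry_sum (X 0)"
      by (simp add: a_def power2_eq_square)
    also have "\<dots> \<le> (real n ^ 2 * \<rho> ^ k * C / p) * (real n ^ 2 * spectral_norm (X 0))"
      using X0_sum \<rho> C p by (intro mult_left_mono) auto
    also have "\<dots> = (real n ^ 4 * C / p) * (\<rho> ^ k * spectral_norm (X 0))"
      by (simp add: power2_eq_square power4_eq_xxxx)
    also have "\<dots> \<le> \<beta> * (\<rho> ^ k * spectral_norm (X 0))"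
      using norm0 \<rho> by (intro mult_right_mono) (auto simp: \<beta>_def)
    finally show ?thesis by (simp add: mult_ac)
  qed
  then have "\<forall>X :: nat \<Rightarrow> real mat. X 0 \<in> psd_mats n \<and> (\<forall>k. X (Suc k) = D (X k)) \<longrightarrow>
      (\<forall>k. spectral_norm (X k) \<le> \<beta> * \<rho> ^ k * spectral_norm (X 0))"
    by blast
  moreover have "\<beta> \<ge> 1" by (simp add: \<beta>_def)
  ultimately show ?thesis unfolding exp_stable_def using \<rho> by blast
qed

end

section \<open>Passage to the adjoint and the equivalences\<close>

lemma spectrum_transpose:
  fixes A :: "'a :: field mat"
  assumes "A \<in> carrier_mat m m"
  shows "spectrum (A\<^sup>T) = spectrum A"
  unfolding spectrum_def eigenvalue_root_char_poly[OF assms, abs_def]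
    eigenvalue_root_char_poly[OF transpose_carrier_mat[THEN iffD2, OF assms], abs_def]
    char_poly_transpose_mat[OF assms] ..

lemma schur_stable_transpose:
  assumes "A \<in> carrier_mat m m"
  shows "schur_stable (A\<^sup>T) \<longleftrightarrow> schur_stable A"
proof -
  have "cplx_mat (A\<^sup>T) = (cplx_mat A)\<^sup>T" by (intro eq_matI) auto
  then show ?thesis
    unfolding schur_stable_def using spectrum_transpose[of "cplx_mat A" m] assms by simp
qed

theorem theorem4p4:
  fixes n N :: nat and J :: "nat \<Rightarrow> real mat"
  assumes "\<And>i. i \<le> N \<Longrightarrow> J i \<in> carrier_mat n n"
  shows
    "(exp_stable n (D_op n N J)
       \<longleftrightarrow> (\<exists>P \<in> pd_mats n. \<exists>Q \<in> pd_mats n. D_adj n N J P - P + Q = 0\<^sub>m n n))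
     \<and> ((\<exists>P \<in> pd_mats n. \<exists>Q \<in> pd_mats n. D_adj n N J P - P + Q = 0\<^sub>m n n)
       \<longleftrightarrow> (\<exists>P \<in> pd_mats n. \<exists>\<alpha>\<^sub>3 > 0. loewner_le n (D_adj n N J P - P) (- \<alpha>\<^sub>3 \<cdot>\<^sub>m 1\<^sub>m n)))
     \<and> (exp_stable n (D_op n N J) \<longleftrightarrow> schur_stable (M_D n N J))
     \<and> (exp_stable n (D_op n N J) \<longleftrightarrow> sp n (D_op n N J) \<subseteq> unit_disc)"
proof -
  interpret S: completely_positive n N J by unfold_locales (rule assms)
  interpret T: completely_positive n N "\<lambda>i. (J i)\<^sup>T" by (rule S.transposed)
  have adj: "D_adj n N J = T.D" by (intro ext) (simp add: D_adj_def D_op_def)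
  let ?a = "exp_stable n S.D" and ?c = "schur_stable S.M" and ?d = "sp n S.D \<subseteq> unit_disc"
  let ?b = "\<exists>P \<in> pd_mats n. \<exists>Q \<in> pd_mats n. T.D P - P + Q = 0\<^sub>m n n"
  \<comment> \<open>The normalised equation with \<open>Q = I\<close> is what the continuation
    argument delivers; both forms of (b) follow from it.\<close>
  let ?b1 = "\<exists>P \<in> pd_mats n. T.D P - P + 1\<^sub>m n = 0\<^sub>m n n"
  let ?b' = "\<exists>P \<in> pd_mats n. \<exists>\<alpha>\<^sub>3 > 0. loewner_le n (T.D P - P) (- \<alpha>\<^sub>3 \<cdot>\<^sub>m 1\<^sub>m n)"
  have ac: "?a \<Longrightarrow> ?c" by (rule S.exp_stable_imp_schur_stable)
  have cd: "?c \<Longrightarrow> ?d" by (rule S.schur_stable_imp_sp)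
  \<comment> \<open>The Lyapunov equation is solved here for \<open>D\<close> itself, which closes
    the cycle through (a), (c) and (d).\<close>
  have da: "?d \<Longrightarrow> ?a"
    using S.sp_imp_lyapunov S.lyapunov_imp_exp_stable pd_mats_one by metis
  have schur: "schur_stable T.M \<longleftrightarrow> ?c"
    unfolding S.M_transposed by (rule schur_stable_transpose[OF S.M_carrier])
  \<comment> \<open>Schur stability passes to the transposed matrix, and the implications already
    shown for the transposed family solve the equation for the adjoint. The converse
    \<open>bc\<close> returns along the same bridge.\<close>
  have cb1: "?c \<Longrightarrow> ?b1"
    using schur T.schur_stable_imp_sp T.sp_imp_lyapunov by metis
  have b1b: "?b1 \<Longrightarrow> ?b" using pd_mats_one by blast
  have bc: "?b \<Longrightarrow> ?c"
    using schur T.lyapunov_imp_exp_stable T.exp_stable_imp_schur_stable by blast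
  have diff: "T.D P - P \<in> sym_mats n" "T.D P \<in> sym_mats n" "P \<in> sym_mats n" if "P \<in> pd_mats n" for P
    using that by (auto simp: pd_mats_iff intro: sym_mats_diff T.D_sym)
  have negI: "- a \<cdot>\<^sub>m 1\<^sub>m n \<in> sym_mats n" for a :: real by (rule sym_mats_smult[OF sym_mats_one])
  have b1b': ?b' if ?b1
  proof -
    obtain P where P: "P \<in> pd_mats n" and eq: "T.D P - P + 1\<^sub>m n = 0\<^sub>m n n" using \<open>?b1\<close> by blast
    note d = diff[OF P]
    have "- 1 \<cdot>\<^sub>m 1\<^sub>m n - (T.D P - P) \<in> psd_mats n"
      unfolding psd_mats_iff
    proof (intro conjI ballI sym_mats_diff[OF negI d(1)])
      fix v :: "real vec" assume v: "v \<in> carrier_vec n"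
      have "qf (T.D P - P + 1\<^sub>m n) v = 0" unfolding eq using v by (simp add: qf_sum[of _ n])
      then have "qf (T.D P - P) v = - (v \<bullet> v)"
        using qf_add[OF sym_mats_carrier[OF d(1)] one_carrier_mat v] qf_one[OF v] by simp
      then show "qf (- 1 \<cdot>\<^sub>m 1\<^sub>m n - (T.D P - P)) v \<ge> 0"
        unfolding qf_diff[OF sym_mats_carrier[OF negI] sym_mats_carrier[OF d(1)] v]
          qf_smult[OF one_carrier_mat v] using qf_one[OF v] by simp
    qed
    then have le: "loewner_le n (T.D P - P) (- 1 \<cdot>\<^sub>m 1\<^sub>m n)"
      using d(1) negI[of 1] by (simp add: loewner_le_def)
    show ?b' by (intro bexI[OF _ P] exI[of _ "1::real"] conjI less_numeral_extra(1) le)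
  qed
  have b'b: ?b if ?b'
  proof -
    obtain P and \<alpha> :: real where P: "P \<in> pd_mats n" and \<alpha>: "\<alpha> > 0"
      and "loewner_le n (T.D P - P) (- \<alpha> \<cdot>\<^sub>m 1\<^sub>m n)"
      using \<open>?b'\<close> by (elim bexE exE conjE)
    then have le: "- \<alpha> \<cdot>\<^sub>m 1\<^sub>m n - (T.D P - P) \<in> psd_mats n" by (simp only: loewner_le_def)
    note d = diff[OF P]
    note c = sym_mats_carrier[OF d(1)] sym_mats_carrier[OF d(2)] sym_mats_carrier[OF d(3)]
    \<comment> \<open>The witness for \<open>Q\<close> is forced by the equation; the Loewner
      inequality makes it dominate \<open>\<alpha> I\<close>.\<close>
    have "P - T.D P \<in> pd_mats n"
      unfolding pd_mats_iff
    proof (intro conjI ballI impI sym_mats_diff[OF d(3,2)])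
      fix v :: "real vec" assume v: "v \<in> carrier_vec n" "v \<noteq> 0\<^sub>v n"
      have "0 \<le> qf (- \<alpha> \<cdot>\<^sub>m 1\<^sub>m n - (T.D P - P)) v" using le v by (simp add: psd_mats_iff)
      also have "\<dots> = - \<alpha> * (v \<bullet> v) - (qf (T.D P) v - qf P v)"
        unfolding qf_diff[OF sym_mats_carrier[OF negI] c(1) v(1)] qf_diff[OF c(2,3) v(1)]
          qf_smult[OF one_carrier_mat v(1)] qf_one[OF v(1)] ..
      finally have "\<alpha> * (v \<bullet> v) \<le> qf (P - T.D P) v"
        unfolding qf_diff[OF c(3,2) v(1)] by simp
      moreover have "\<alpha> * (v \<bullet> v) > 0" using \<alpha> scalar_prod_self_pos[OF v] by simp
      ultimately show "qf (P - T.D P) v > 0" by linarith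
    qed
    moreover have "T.D P - P + (P - T.D P) = 0\<^sub>m n n" using c by (intro eq_matI) auto
    ultimately show ?b using P by blast
  qed
  show ?thesis unfolding adj using ac cd da cb1 b1b bc b1b' b'b by blast
qed

end
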